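(* Let $k\in\mathrm{Pos}^s_\nu$ and define $\mathbf{K}^{\rm lyap}_\nu(j):=\min_{(P,t)\in\mathcal{L}(A,Q)}\mathbf{K}^{\rm lyap}_\nu(j,P,t)$ for $j\in\mathrm{Pos}^s_\nu$. Then: 1. for all $P\in\mathcal{L}_A$, the function $\mathcal{T}_Q(P)\ni t\mapsto \mathbf{K}^{\rm lyap}_\nu(k,P,t)$ is increasing (in the wide sense, i.e. nondecreasing); 2. $\mathbf{K}^{\rm lyap}_\nu(k)=\min_{P\in\mathcal{L}_A}\mathbf{K}^{\rm lyap}_\nu\left(k,P,t_Q^*(P)\right)$; 3. $\mathbf{K}_\nu<\mathbf{K}^{\rm lyap}_\nu(k)$; 4. $\mathbf{K}^{\rm lyap}_\nu(\mathbf{K}_\nu)=\min_{j\in\mathrm{Pos}^s_\nu}\mathbf{K}^{\rm lyap}_\nu(j)$; 5. for all $k\in\mathrm{Pos}^s_\nu$, $\max_{j\in\mathbb{N}}\nu_j=\max_{0\leq j\leq \mathbf{K}^{\rm lyap}_\nu(\mathbf{K}_\nu)-1}\nu_j=\max_{0\leq j\leq \mathbf{K}^{\rm lyap}_\nu(k)-1}\nu_j$.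
   Context: Data: $d\geq 1$, $A\in\mathbb{R}^{d\times d}$, $Q\in\mathbb{R}^{d\times d}$ symmetric, $q\in\mathbb{R}^d$, and $X^{\rm in}\subset\mathbb{R}^d$ a nonempty polytope (bounded). Standing assumptions: $0<\rho(A)<1$ ($\rho$ = spectral radius); $X^{\rm in}\neq\{0\}$; if $Q\preceq 0$ then $q\neq 0$. $\mathbb{N}$ contains $0$, $\mathbb{R}_+=[0,+\infty)$. For $k\in\mathbb{N}$, $\nu_k:=\max_{x\in X^{\rm in}}\left(x^\intercal (A^k)^\intercal Q A^k x+q^\intercal A^k x\right)$, $\mathrm{Pos}^s_\nu:=\{k\in\mathbb{N}:\nu_k>0\}$, and $\mathbf{K}_\nu:=\inf\{k\in\mathbb{N}:\max_{0\leq j\leq k}\nu_j\geq\sup_{j>k}\nu_j\}$ (when $\mathrm{Pos}^s_\nu\neq\emptyset$, this is the smallest $k$ with $\nu_k=\max_{j\in\mathbb{N}}\nu_j$). For Hermitian matrices, $B\succ0$ (resp. $B\succeq 0$) means positive definite (resp. semidefinite). $\mathcal{L}_A:=\{P\in\mathbb{C}^{d\times d}\text{ Hermitian}: P\succ 0,\ P-A^\intercal PA\succ 0\}$. For $P\succ 0$: $\|x\|_P:=\sqrt{x^*Px}$ on $\mathbb{C}^d$, $\|A\|_P:=\max_{x\neq0}\|Ax\|_P/\|x\|_P$, $\|y\|_P^*:=\sqrt{y^*P^{-1}y}$, $\mu(P):=\max_{x\in X^{\rm in}}x^\intercal Px$, $\mathcal{T}_Q(P):=\{t\in\mathbb{R}_+: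 tP-Q\succeq0\}$, and $t_Q^*(P):=\max\{\lambda_{\max}(P^{-1/2}QP^{-1/2}),0\}$ (the smallest element of $\mathcal{T}_Q(P)$). Let $\mathcal{L}(A,Q):=\{(P,t): P\in\mathcal{L}_A,\ t\in\mathcal{T}_Q(P)\}$. For $(P,t)\in\mathcal{L}(A,Q)$ and $x\in\mathbb{R}_+$, $H_{P,t}(x):=x\sqrt{\mu(P)}\,\|q\|_P^*$ if $t=0$, and $H_{P,t}(x):=\left(\sqrt{t\mu(P)}\,x+\frac{\|q\|_P^*}{2\sqrt t}\right)^2-\frac{(\|q\|_P^* )^2}{4t}$ if $t>0$. It is a strictly increasing homeomorphism of $\mathbb{R}_+$, with inverse $H_{P,t}^{-1}$. Standing assumption: $\nu_0<H_{P,t}(1)$ for all $(P,t)\in\mathcal{L}(A,Q)$. For $k\in\mathrm{Pos}^s_\nu$ and $(P,t)\in\mathcal{L}(A,Q)$: $\mathbf{K}^{\rm lyap}_\nu(k,P,t):=\left\lfloor \frac{\ln\left(H_{P,t}^{-1}(\nu_k)\right)}{\ln\|A\|_P}\right\rfloor+1$. *)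

theory Defs
  imports "HOL-Analysis.Analysis"
begin

definition is_minimum :: "'a::order set \<Rightarrow> 'a \<Rightarrow> bool" where
  "is_minimum S m \<longleftrightarrow> m \<in> S \<and> (\<forall>s\<in>S. m \<le> s)"

definition is_maximum :: "'a::order set \<Rightarrow> 'a \<Rightarrow> bool" where
  "is_maximum S m \<longleftrightarrow> m \<in> S \<and> (\<forall>s\<in>S. s \<le> m)"


section \<open>Matrices\<close>

text \<open>The operation \<open>^\<close> on \<open>'a^'n^'n\<close> is the entrywise power, so powers with respect to
  the matrix product need their own function.\<close>

primrec matpow :: "'a::semiring_1^'n^'n \<Rightarrow> nat \<Rightarrow> 'a^'n^'n" where
  "matpow A 0 = mat 1"
| "matpow A (Suc k) = A ** matpow A k"

definition cvec :: "real^'n \<Rightarrow> complex^'n" where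
  "cvec x = (\<chi> i. complex_of_real (x $ i))"

definition cmat :: "real^'n^'m \<Rightarrow> complex^'n^'m" where
  "cmat A = map_matrix complex_of_real A"

definition eigenvalues :: "complex^'n^'n \<Rightarrow> complex set" where
  "eigenvalues B = {l. \<exists>v. v \<noteq> 0 \<and> B *v v = l *s v}"

definition spectral_radius :: "real^'n^'n \<Rightarrow> real" where
  "spectral_radius A = Max (cmod ` eigenvalues (cmat A))"

definition hermitian :: "complex^'n^'n \<Rightarrow> bool" where
  "hermitian B \<longleftrightarrow> (\<forall>i j. B $ i $ j = cnj (B $ j $ i))"

text \<open>The form \<open>x\<^sup>* B x\<close>; for Hermitian \<open>B\<close> it is real, and only its real part is used.\<close>

definition cform :: "complex^'n^'n \<Rightarrow> complex^'n \<Rightarrow> complex" where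
  "cform B x = (\<Sum>i\<in>UNIV. cnj (x $ i) * (B *v x) $ i)"

definition pos_def :: "complex^'n^'n \<Rightarrow> bool" where
  "pos_def B \<longleftrightarrow> hermitian B \<and> (\<forall>x. x \<noteq> 0 \<longrightarrow> Re (cform B x) > 0)"

definition pos_semidef :: "complex^'n^'n \<Rightarrow> bool" where
  "pos_semidef B \<longleftrightarrow> hermitian B \<and> (\<forall>x. Re (cform B x) \<ge> 0)"

text \<open>The square root and the largest eigenvalue below are meant for positive semidefinite and
  for Hermitian arguments, respectively.\<close>

definition mat_sqrt :: "complex^'n^'n \<Rightarrow> complex^'n^'n" where
  "mat_sqrt P = (THE S. pos_semidef S \<and> S ** S = P)"

definition lambda_max :: "complex^'n^'n \<Rightarrow> real" where
  "lambda_max B = Max {l. complex_of_real l \<in> eigenvalues B}"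


section \<open>The sequence of maxima\<close>

text \<open>The suprema over \<open>X\<close> here and in \<open>mu\<close> are maxima when \<open>X\<close> is a nonempty polytope, by
  compactness.\<close>

definition nu :: "real^'n^'n \<Rightarrow> real^'n^'n \<Rightarrow> real^'n \<Rightarrow> (real^'n) set \<Rightarrow> nat \<Rightarrow> real" where
  "nu A Q q X k =
    (SUP x\<in>X. x \<bullet> ((transpose (matpow A k) ** Q ** matpow A k) *v x) + q \<bullet> (matpow A k *v x))"

definition Pos_nu :: "real^'n^'n \<Rightarrow> real^'n^'n \<Rightarrow> real^'n \<Rightarrow> (real^'n) set \<Rightarrow> nat set" where
  "Pos_nu A Q q X = {k. nu A Q q X k > 0}"

definition dominating :: "real^'n^'n \<Rightarrow> real^'n^'n \<Rightarrow> real^'n \<Rightarrow> (real^'n) set \<Rightarrow> nat set" where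
  "dominating A Q q X =
    {k. Max (nu A Q q X ` {0..k}) \<ge> (SUP j\<in>{k<..}. nu A Q q X j)}"

text \<open>The convention that the infimum of the empty set is \<open>+\<infinity>\<close> is not captured by this
  \<open>nat\<close>-valued infimum: finiteness of the mathematical infimum is
  \<open>dominating A Q q X \<noteq> {}\<close>.\<close>

definition K_nu :: "real^'n^'n \<Rightarrow> real^'n^'n \<Rightarrow> real^'n \<Rightarrow> (real^'n) set \<Rightarrow> nat" where
  "K_nu A Q q X = Inf (dominating A Q q X)"


section \<open>Lyapunov norms\<close>

definition lyap :: "real^'n^'n \<Rightarrow> (complex^'n^'n) set" where
  "lyap A = {P. pos_def P \<and> pos_def (P - cmat (transpose A) ** P ** cmat A)}"

definition norm_P :: "complex^'n^'n \<Rightarrow> complex^'n \<Rightarrow> real" where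
  "norm_P P x = sqrt (Re (cform P x))"

definition opnorm_P :: "complex^'n^'n \<Rightarrow> real^'n^'n \<Rightarrow> real" where
  "opnorm_P P A = (SUP x\<in>{x. x \<noteq> 0}. norm_P P (cmat A *v x) / norm_P P x)"

definition dual_norm_P :: "complex^'n^'n \<Rightarrow> complex^'n \<Rightarrow> real" where
  "dual_norm_P P y = sqrt (Re (cform (matrix_inv P) y))"

definition mu :: "(real^'n) set \<Rightarrow> complex^'n^'n \<Rightarrow> real" where
  "mu X P = (SUP x\<in>X. Re (cform P (cvec x)))"

definition T_set :: "real^'n^'n \<Rightarrow> complex^'n^'n \<Rightarrow> real set" where
  "T_set Q P = {t. t \<ge> 0 \<and> pos_semidef (t *\<^sub>R P - cmat Q)}"

definition t_star :: "real^'n^'n \<Rightarrow> complex^'n^'n \<Rightarrow> real" where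
  "t_star Q P =
    max (lambda_max (matrix_inv (mat_sqrt P) ** cmat Q ** matrix_inv (mat_sqrt P))) 0"

definition lyap_pairs :: "real^'n^'n \<Rightarrow> real^'n^'n \<Rightarrow> ((complex^'n^'n) \<times> real) set" where
  "lyap_pairs A Q = (SIGMA P:lyap A. T_set Q P)"


section \<open>Upper bounds on the argument of the maximum\<close>

definition H :: "real^'n \<Rightarrow> (real^'n) set \<Rightarrow> complex^'n^'n \<Rightarrow> real \<Rightarrow> real \<Rightarrow> real" where
  "H q X P t x =
    (if t = 0 then x * sqrt (mu X P) * dual_norm_P P (cvec q)
     else (sqrt (t * mu X P) * x + dual_norm_P P (cvec q) / (2 * sqrt t))\<^sup>2
            - (dual_norm_P P (cvec q))\<^sup>2 / (4 * t))"

definition H_inv :: "real^'n \<Rightarrow> (real^'n) set \<Rightarrow> complex^'n^'n \<Rightarrow> real \<Rightarrow> real \<Rightarrow> real" where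
  "H_inv q X P t = inv_into {0..} (H q X P t)"

definition K_lyap_at ::
  "real^'n^'n \<Rightarrow> real^'n^'n \<Rightarrow> real^'n \<Rightarrow> (real^'n) set \<Rightarrow> nat \<Rightarrow> complex^'n^'n \<Rightarrow> real \<Rightarrow> int" where
  "K_lyap_at A Q q X k P t =
    \<lfloor>ln (H_inv q X P t (nu A Q q X k)) / ln (opnorm_P P A)\<rfloor> + 1"

definition K_lyap ::
  "real^'n^'n \<Rightarrow> real^'n^'n \<Rightarrow> real^'n \<Rightarrow> (real^'n) set \<Rightarrow> nat \<Rightarrow> int" where
  "K_lyap A Q q X j = (LEAST m. m \<in> (\<lambda>(P, t). K_lyap_at A Q q X j P t) ` lyap_pairs A Q)"

end

theory Submission
  imports Defs "HOL-Computational_Algebra.Fundamental_Theorem_Algebra"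
begin

text \<open>Fix \<open>P \<in> lyap A\<close> and \<open>t \<in> T_set Q P\<close>, and let \<open>a = opnorm_P P A\<close>, which lies strictly between
  0 and 1. Then \<open>nu j \<le> H (a ^ j)\<close> for every \<open>j\<close> (\<open>nu_le_H\<close>): the sequence lies below an envelope
  which decreases to zero. Unfolding the logarithms, \<open>K_lyap_at j P t\<close> is, for
  \<open>nu j > 0\<close>, the first exponent \<open>i\<close> with \<open>H (a ^ i) < nu j\<close> (\<open>less_K_lyap_at_iff\<close>). From this description the claims follow by
  comparison:

  \<^item> \<open>H\<close> increases with \<open>t\<close>, so the envelope crosses the level \<open>nu j\<close> later for larger \<open>t\<close>, and the
    least admissible \<open>t\<close>, which is \<open>t_star\<close> (\<open>t_star_is_minimum\<close>), gives the least bound for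
    given \<open>P\<close>.

  \<^item> From \<open>K_lyap_at j P t\<close> on, the sequence stays below \<open>nu j\<close>. Hence the maximum is attained before
    this index (\<open>first_dominating_index\<close>), and it suffices to search up to there.

  \<^item> The envelope crosses a higher level earlier, so the bound is least at the index \<open>K_nu\<close> of the
    maximum.

  The bound \<open>K_lyap_at j P t\<close> is an integer larger than \<open>j\<close>, so minima over \<open>P\<close> and \<open>t\<close> exist as soon
  as there is an admissible pair. A matrix in \<open>lyap A\<close> is the Gram series of the powers of \<open>A\<close>
  (\<open>lyap_nonempty\<close>). Its convergence is derived from \<open>spectral_radius A < 1\<close> with the help of an
  annihilating polynomial (\<open>summable_orbit_of_annihilated\<close>).

  Complex vectors are treated as a real Euclidean space, on which Hermitian matrices are
  self-adjoint operators. The maximum of the Rayleigh quotient (\<open>rayleigh_eigenvector\<close>) then yields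
  all that is needed about them: the square root \<open>mat_sqrt P\<close>, the variational description of
  \<open>lambda_max\<close>, and two-sided bounds for positive definite forms.\<close>

section \<open>Self-adjoint operators on Euclidean spaces\<close>

text \<open>Symmetry is meant for the real inner product. On \<open>complex^'n\<close> this is the real part of the
  Hermitian product, so that one theory of real self-adjoint operators covers Hermitian matrices
  and leaves complex linearity as a separate property.\<close>

definition selfadj :: "('a::real_inner \<Rightarrow> 'a) \<Rightarrow> bool" where
  "selfadj f \<longleftrightarrow> linear f \<and> (\<forall>x y. f x \<bullet> y = x \<bullet> f y)"

lemma selfadj_linear: "selfadj f \<Longrightarrow> linear f"
  and selfadj_inner: "selfadj f \<Longrightarrow> f x \<bullet> y = x \<bullet> f y"
  by (simp_all add: selfadj_def)

text \<open>Moving from \<open>v\<close> a little in the direction \<open>\<plusminus> w\<close> changes the form to first order by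
  \<open>2 (g v \<bullet> w)\<close>; at a zero of a nonnegative form this first-order term has to vanish.\<close>

lemma psd_form_kernel:
  fixes g :: "'a::real_inner \<Rightarrow> 'a"
  assumes g: "selfadj g" and V: "subspace V"
    and nn: "\<And>x. x \<in> V \<Longrightarrow> 0 \<le> x \<bullet> g x"
    and v: "v \<in> V" "v \<bullet> g v = 0" and w: "w \<in> V"
  shows "g v \<bullet> w = 0"
proof (rule ccontr)
  assume "g v \<bullet> w \<noteq> 0"
  define b where "b = g v \<bullet> w"
  define c where "c = w \<bullet> g w"
  have b: "b \<noteq> 0" using \<open>g v \<bullet> w \<noteq> 0\<close> by (simp add: b_def)
  have c: "c \<ge> 0" using nn w by (simp add: c_def)
  \<comment> \<open>The minimizer of \<open>2 s b + s\<^sup>2 c\<close> is \<open>- b / c\<close>; the summand 1 covers the case \<open>c = 0\<close>.\<close>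
  define s where "s = - b / (c + 1)"
  have lin: "g (v + s *\<^sub>R w) = g v + s *\<^sub>R g w"
    using selfadj_linear[OF g] by (simp add: linear_add linear_scale)
  have "v + s *\<^sub>R w \<in> V" using V v w by (simp add: subspace_add subspace_scale)
  then have "0 \<le> (v + s *\<^sub>R w) \<bullet> g (v + s *\<^sub>R w)" by (rule nn)
  also have "\<dots> = 2 * s * b + s\<^sup>2 * c"
    using v(2) selfadj_inner[OF g, of v w]
    by (simp add: lin inner_add_left inner_add_right b_def c_def power2_eq_square inner_commute
        algebra_simps)
  also have "\<dots> = - (s\<^sup>2 * (c + 2))"
  proof -
    have "b = - (s * (c + 1))" using c by (simp add: s_def)
    then show ?thesis by (simp only:) (simp add: algebra_simps power2_eq_square)
  qed
  also have "\<dots> < 0"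
    using b c by (simp add: s_def)
  finally show False by simp
qed

lemma UNIV_not_zero: "(UNIV :: 'a::euclidean_space set) \<noteq> {0}"
  by (metis UNIV_I nonempty_Basis nonzero_Basis all_not_in_conv singletonD)

text \<open>The Rayleigh quotient attains its maximum \<open>l\<close> on the compact unit sphere of \<open>V\<close>. Since
  \<open>l *\<^sub>R x - f x\<close> then has a nonnegative form on \<open>V\<close> which vanishes at the maximizer, the maximizer
  is an eigenvector.\<close>

lemma rayleigh_eigenvector:
  fixes f :: "'a::euclidean_space \<Rightarrow> 'a"
  assumes f: "selfadj f" and V: "subspace V" "V \<noteq> {0}" and fV: "\<And>x. x \<in> V \<Longrightarrow> f x \<in> V"
  obtains v l where "v \<in> V" "norm v = 1" "f v = l *\<^sub>R v"
    "\<And>x. x \<in> V \<Longrightarrow> x \<bullet> f x \<le> l * (x \<bullet> x)"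
proof -
  define S where "S = sphere 0 1 \<inter> V"
  have "compact S" unfolding S_def using V by (intro compact_Int_closed closed_subspace) auto
  obtain u where u: "u \<in> V" "u \<noteq> 0" using V subspace_0 by blast
  then have "u /\<^sub>R norm u \<in> S" using V by (auto simp: S_def subspace_scale)
  then have "S \<noteq> {}" by blast
  have "continuous_on S (\<lambda>x. x \<bullet> f x)"
    using selfadj_linear[OF f]
    by (intro continuous_intros linear_continuous_on) (simp add: linear_conv_bounded_linear)
  with \<open>compact S\<close> \<open>S \<noteq> {}\<close> obtain v where v: "v \<in> S" and vmax: "\<And>x. x \<in> S \<Longrightarrow> x \<bullet> f x \<le> v \<bullet> f v"
    using continuous_attains_sup[of S "\<lambda>x. x \<bullet> f x"] by blast
  define l where "l = v \<bullet> f v"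
  have vV: "v \<in> V" and nv: "norm v = 1" using v by (auto simp: S_def)
  have bound: "x \<bullet> f x \<le> l * (x \<bullet> x)" if "x \<in> V" for x
  proof (cases "x = 0")
    case False
    have "x /\<^sub>R norm x \<in> S" using that V False by (auto simp: S_def subspace_scale)
    from vmax[OF this] have "(x \<bullet> f x) / (norm x)\<^sup>2 \<le> l"
      using selfadj_linear[OF f] by (simp add: linear_scale l_def power2_eq_square field_simps)
    then show ?thesis using False by (simp add: field_simps power2_norm_eq_inner)
  qed auto
  define g where "g = (\<lambda>x. l *\<^sub>R x - f x)"
  have g: "selfadj g"
    using f unfolding selfadj_def g_def
    by (auto simp: inner_diff_left inner_diff_right intro!: linear_compose_sub linear_compose_scale_right linear_ident)
  have "g v \<bullet> g v = 0"
  proof (rule psd_form_kernel[OF g V(1)])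
    show "0 \<le> x \<bullet> g x" if "x \<in> V" for x
      using bound[OF that] by (simp add: g_def inner_diff_right)
    show "v \<bullet> g v = 0" using nv by (simp add: g_def inner_diff_right l_def dot_square_norm)
    show "g v \<in> V" using V vV fV by (simp add: g_def subspace_diff subspace_scale)
  qed (fact vV)
  then have "f v = l *\<^sub>R v" by (simp add: g_def)
  with vV nv bound that show ?thesis by blast
qed

lemma orthonormal_expand:
  fixes E :: "'a::euclidean_space set"
  assumes "finite E" and n: "\<And>e. e \<in> E \<Longrightarrow> norm e = 1" and o: "pairwise orthogonal E"
    and sp: "span E = UNIV"
  shows "(\<Sum>e\<in>E. (x \<bullet> e) *\<^sub>R e) = x"
proof -
  let ?y = "x - (\<Sum>e\<in>E. (x \<bullet> e) *\<^sub>R e)"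
  have "orthogonal ?y e" if e: "e \<in> E" for e
  proof -
    have "(\<Sum>a\<in>E. (x \<bullet> a) *\<^sub>R a) \<bullet> e = (\<Sum>a\<in>E. if a = e then x \<bullet> e else 0)"
      unfolding inner_sum_left
      using o e n[OF e] by (intro sum.cong) (auto simp: pairwise_def orthogonal_def dot_square_norm)
    then show ?thesis using e \<open>finite E\<close> by (simp add: orthogonal_def inner_diff_left)
  qed
  then have "orthogonal ?y ?y"
    using sp by (intro orthogonal_to_span[of ?y E]) auto
  then show ?thesis by (simp add: orthogonal_def)
qed

text \<open>An orthonormal family of eigenvectors that does not span the space has an invariant orthogonal
  complement, and a Rayleigh maximizer in this complement enlarges the family.\<close>

lemma orthonormal_eigenbasis:
  fixes f :: "'a::euclidean_space \<Rightarrow> 'a"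
  assumes f: "selfadj f"
  obtains E where "finite E" "\<And>e. e \<in> E \<Longrightarrow> norm e = 1" "pairwise orthogonal E"
    "span E = UNIV" "\<And>e. e \<in> E \<Longrightarrow> \<exists>l. f e = l *\<^sub>R e"
proof -
  have ex: "\<exists>E. card E = k \<and> finite E \<and> (\<forall>e\<in>E. norm e = 1 \<and> (\<exists>l. f e = l *\<^sub>R e)) \<and> pairwise orthogonal E"
    if "k \<le> DIM('a)" for k
    using that
  proof (induction k)
    case 0
    show ?case by (intro exI[of _ "{}"]) auto
  next
    case (Suc k)
    then obtain E where E: "card E = k" "finite E"
      "\<And>e. e \<in> E \<Longrightarrow> norm e = 1" "\<And>e. e \<in> E \<Longrightarrow> \<exists>l. f e = l *\<^sub>R e" "pairwise orthogonal E"
      by (metis Suc_leD)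
    define V where "V = {x. \<forall>e\<in>E. orthogonal e x}"
    have V: "subspace V"
      unfolding V_def subspace_def orthogonal_def by (auto simp: inner_add_right)
    have "dim (span E) < DIM('a)"
      using E(1,2) Suc.prems dim_le_card'[of E] by (simp add: dim_span)
    then have "span (span E) \<subset> UNIV" using dim_eq_full[of "span E"] by auto
    then obtain z where z: "z \<noteq> 0" "\<And>y. y \<in> span (span E) \<Longrightarrow> orthogonal z y"
      using orthogonal_to_subspace_exists_gen[of "span E" UNIV] by auto
    have "z \<in> V"
      using z(2) by (auto simp: V_def span_base orthogonal_commute)
    then have "V \<noteq> {0}" using z by blast
    have inv: "f x \<in> V" if "x \<in> V" for x
      unfolding V_def
    proof safe
      fix e assume e: "e \<in> E"
      with E obtain l where "f e = l *\<^sub>R e" by blast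
      then show "orthogonal e (f x)"
        using selfadj_inner[OF f, of e x] that e by (simp add: V_def orthogonal_def)
    qed
    from rayleigh_eigenvector[OF f V \<open>V \<noteq> {0}\<close> inv]
    obtain v l where v: "v \<in> V" "norm v = 1" "f v = l *\<^sub>R v" by blast
    have "v \<notin> E" using v by (auto simp: V_def orthogonal_def)
    with E v show ?case
      by (intro exI[of _ "insert v E"])
        (auto simp: pairwise_insert V_def orthogonal_commute)
  qed
  obtain E where E: "card E = DIM('a)" "finite E"
      "\<And>e. e \<in> E \<Longrightarrow> norm e = 1" "\<And>e. e \<in> E \<Longrightarrow> \<exists>l. f e = l *\<^sub>R e" "pairwise orthogonal E"
    using ex[of "DIM('a)"] by auto
  have "0 \<notin> E" using E(3) by fastforce
  then have "independent E" using E(5) pairwise_orthogonal_independent by blast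
  then have "span E = UNIV"
    using E(1,2) by (metis dim_eq_full dim_eq_card_independent)
  with E that show ?thesis by metis
qed

lemma square_root_exists:
  fixes f :: "'a::euclidean_space \<Rightarrow> 'a"
  assumes f: "selfadj f" and nn: "\<And>x. 0 \<le> x \<bullet> f x"
  obtains s where "selfadj s" "\<And>x. 0 \<le> x \<bullet> s x" "\<And>x. s (s x) = f x"
proof -
  obtain E where E: "finite E" "\<And>e. e \<in> E \<Longrightarrow> norm e = 1" "pairwise orthogonal E"
    "span E = UNIV" "\<And>e. e \<in> E \<Longrightarrow> \<exists>l. f e = l *\<^sub>R e"
    using orthonormal_eigenbasis[OF f] by metis
  then obtain l where l: "\<And>e. e \<in> E \<Longrightarrow> f e = l e *\<^sub>R e" by metis
  have lpos: "l e \<ge> 0" if "e \<in> E" for e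
    using nn[of e] l[OF that] E(2)[OF that] by (simp add: dot_square_norm)
  define s where "s = (\<lambda>x. \<Sum>e\<in>E. (sqrt (l e) * (x \<bullet> e)) *\<^sub>R e)"
  have lin: "linear s"
    unfolding s_def
    by (intro linear_compose_sum ballI, rule linearI)
      (auto simp: inner_add_left algebra_simps)
  have se: "s e = sqrt (l e) *\<^sub>R e" if e: "e \<in> E" for e
  proof -
    have "s e = (\<Sum>a\<in>E. if a = e then sqrt (l e) *\<^sub>R e else 0)"
      unfolding s_def using E(3) e E(2)[OF e]
      by (intro sum.cong) (auto simp: pairwise_def orthogonal_def dot_square_norm)
    then show ?thesis using e E(1) by simp
  qed
  have "s (s x) = f x" for x
  proof -
    have "s (s x) = (\<Sum>e\<in>E. (sqrt (l e) * (x \<bullet> e)) *\<^sub>R s e)"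
      unfolding s_def[THEN fun_cong, of x] by (simp add: linear_sum[OF lin] linear_scale[OF lin])
    also have "\<dots> = (\<Sum>e\<in>E. (x \<bullet> e) *\<^sub>R f e)"
      using lpos by (intro sum.cong) (auto simp: se l)
    also have "\<dots> = f (\<Sum>e\<in>E. (x \<bullet> e) *\<^sub>R e)"
      using selfadj_linear[OF f] by (simp add: linear_sum linear_scale)
    also have "\<dots> = f x"
      by (simp only: orthonormal_expand[OF E(1-4)])
    finally show ?thesis .
  qed
  moreover have "s x \<bullet> y = x \<bullet> s y" for x y
    by (simp add: s_def inner_sum_left inner_sum_right inner_commute mult_ac)
  moreover have "0 \<le> x \<bullet> s x" for x
    using lpos by (auto simp: s_def inner_sum_right mult.assoc intro!: sum_nonneg)
  ultimately show ?thesis using lin that[of s] by (auto simp: selfadj_def)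
qed

lemma square_root_pos:
  fixes s :: "'a::real_inner \<Rightarrow> 'a"
  assumes s: "selfadj s" and nn: "\<And>x. 0 \<le> x \<bullet> s x" and x: "s (s x) \<noteq> 0"
  shows "0 < x \<bullet> s x"
proof (rule ccontr)
  assume "\<not> 0 < x \<bullet> s x"
  then have "x \<bullet> s x = 0" using nn[of x] by simp
  then have "s x \<bullet> s x = 0" using psd_form_kernel[OF s subspace_UNIV] nn by blast
  then show False using x linear_0[OF selfadj_linear[OF s]] by simp
qed

text \<open>The difference \<open>d = s - t\<close> of two square roots of the same operator satisfies
  \<open>d (s v) + t (d v) = 0\<close>. Pairing this with an eigenvector \<open>v\<close> of \<open>d\<close> shows that its eigenvalue is
  zero, because the form of \<open>s + t\<close> is positive, in particular for the \<open>v\<close> which maximizes the Rayleigh quotient of \<open>d\<close>.\<close>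

lemma form_le_0_of_same_square:
  fixes s t :: "'a::euclidean_space \<Rightarrow> 'a"
  assumes s: "selfadj s" and t: "selfadj t"
    and pos: "\<And>x. x \<noteq> 0 \<Longrightarrow> 0 < x \<bullet> s x + x \<bullet> t x"
    and eq: "\<And>x. s (s x) = t (t x)"
  shows "x \<bullet> (s x - t x) \<le> 0"
proof -
  define d where "d = (\<lambda>x. s x - t x)"
  have d: "selfadj d"
    using s t unfolding selfadj_def d_def
    by (auto simp: inner_diff_left inner_diff_right intro!: linear_compose_sub)
  from rayleigh_eigenvector[OF d subspace_UNIV UNIV_not_zero UNIV_I]
  obtain v l where v: "norm v = 1" "d v = l *\<^sub>R v" and bound: "\<And>x. x \<bullet> d x \<le> l * (x \<bullet> x)"
    by (metis UNIV_I)
  have "d (s v) + t (d v) = 0"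
    using eq[of v] linear_diff[OF selfadj_linear[OF t]] by (simp add: d_def)
  then have "0 = v \<bullet> d (s v) + v \<bullet> t (d v)" by (metis inner_add_right inner_zero_right)
  also have "\<dots> = d v \<bullet> s v + d v \<bullet> t v"
    by (metis selfadj_inner[OF d] selfadj_inner[OF t] inner_commute)
  also have "\<dots> = l * (v \<bullet> s v + v \<bullet> t v)" by (simp add: v algebra_simps)
  finally have "l = 0" using pos[of v] v(1) by fastforce
  with bound[of x] show ?thesis by (simp add: d_def)
qed

lemma square_root_unique:
  fixes s t :: "'a::euclidean_space \<Rightarrow> 'a"
  assumes s: "selfadj s" and t: "selfadj t"
    and pos: "\<And>x. x \<noteq> 0 \<Longrightarrow> 0 < x \<bullet> s x" and nn: "\<And>x. 0 \<le> x \<bullet> t x"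
    and eq: "\<And>x. s (s x) = t (t x)"
  shows "s = t"
proof
  fix x
  define d where "d = (\<lambda>x. s x - t x)"
  have d: "selfadj d"
    using s t unfolding selfadj_def d_def
    by (auto simp: inner_diff_left inner_diff_right intro!: linear_compose_sub)
  have "y \<bullet> d y \<le> 0" for y
    unfolding d_def using pos nn eq
    by (intro form_le_0_of_same_square[OF s t]) (auto intro: add_pos_nonneg)
  moreover have "y \<bullet> d y \<ge> 0" for y
    using form_le_0_of_same_square[OF t s, of y] pos nn eq
    by (auto simp: d_def inner_diff_right intro: add_nonneg_pos)
  ultimately have "y \<bullet> d y = 0" for y by (simp add: order_antisym)
  then have "d x \<bullet> d x = 0"
    by (intro psd_form_kernel[OF d subspace_UNIV]) auto
  then show "s x = t x" by (simp add: d_def)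
qed

section \<open>Hermitian complex matrices as self-adjoint operators\<close>

lemma Re_cform: "Re (cform B x) = x \<bullet> (B *v x)"
  by (simp add: cform_def inner_vec_def inner_complex_def)

lemma scalar_mult_Re_Im: "(c::complex) *s x = Re c *\<^sub>R x + Im c *\<^sub>R (\<i> *s x)"
  by (simp add: vec_eq_iff complex_eq_iff)

lemma inner_imaginary: "x \<bullet> (\<i> *s y) = - ((\<i> *s x) \<bullet> (y :: complex^'n))"
  by (simp add: inner_vec_def inner_complex_def sum_negf[symmetric])

lemma inner_eq_Re: "(x :: complex^'n) \<bullet> y = Re (\<Sum>i\<in>UNIV. cnj (x $ i) * y $ i)"
  by (simp add: inner_vec_def inner_complex_def)

lemma matrix_vector_axis: "((B :: complex^'n^'m) *v axis j c) $ i = B $ i $ j * c"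
  by (simp add: matrix_vector_mult_def axis_def if_distrib[of "\<lambda>x. _ * x"] cong: if_cong)

lemma hermitian_iff_selfadj: "hermitian B \<longleftrightarrow> selfadj ((*v) B)"
proof
  assume B: "hermitian B"
  have eq: "cnj (B $ i $ j * x) * y = cnj x * (B $ j $ i * y)" for i j x y
    using B by (metis (no_types, lifting) complex_cnj_mult hermitian_def mult.assoc mult.commute)
  have "(B *v x) \<bullet> y = x \<bullet> (B *v y)" for x y
  proof -
    have "(\<Sum>i\<in>UNIV. cnj ((B *v x) $ i) * y $ i)
        = (\<Sum>i\<in>UNIV. \<Sum>j\<in>UNIV. cnj (B $ i $ j * x $ j) * y $ i)"
      by (simp add: matrix_vector_mult_def sum_distrib_right)
    also have "\<dots> = (\<Sum>j\<in>UNIV. \<Sum>i\<in>UNIV. cnj (x $ j) * (B $ j $ i * y $ i))"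
      unfolding eq by (rule sum.swap)
    also have "\<dots> = (\<Sum>j\<in>UNIV. cnj (x $ j) * (B *v y) $ j)"
      by (simp add: matrix_vector_mult_def sum_distrib_left)
    finally show ?thesis by (simp only: inner_eq_Re)
  qed
  then show "selfadj ((*v) B)" by (simp add: selfadj_def)
next
  assume B: "selfadj ((*v) B)"
  have "(B *v axis i 1) \<bullet> axis j c = axis i 1 \<bullet> (B *v axis j c)" for i j c
    using B by (rule selfadj_inner)
  then have eq: "(B $ j $ i) \<bullet> c = 1 \<bullet> (B $ i $ j * c)" for i j c
    by (simp add: inner_axis inner_axis' matrix_vector_axis)
  show "hermitian B"
    unfolding hermitian_def
  proof (intro allI)
    fix i j
    from eq[of j i 1] eq[of j i "\<i>"] show "B $ i $ j = cnj (B $ j $ i)"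
      by (simp add: complex_eq_iff inner_complex_def)
  qed
qed

lemma pos_semidef_iff: "pos_semidef B \<longleftrightarrow> selfadj ((*v) B) \<and> (\<forall>x. 0 \<le> x \<bullet> (B *v x))"
  by (simp add: pos_semidef_def Re_cform hermitian_iff_selfadj)

lemma pos_def_iff: "pos_def B \<longleftrightarrow> selfadj ((*v) B) \<and> (\<forall>x. x \<noteq> 0 \<longrightarrow> 0 < x \<bullet> (B *v x))"
  by (simp add: pos_def_def Re_cform hermitian_iff_selfadj)

lemma pos_def_imp_pos_semidef: "pos_def B \<Longrightarrow> pos_semidef B"
  unfolding pos_def_iff pos_semidef_iff by (metis inner_zero_left less_eq_real_def)

lemma pos_def_inverse:
  assumes "pos_def P"
  shows "P ** matrix_inv P = mat 1" "matrix_inv P ** P = mat 1"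
proof -
  have "\<forall>x. P *v x = 0 \<longrightarrow> x = 0"
    using assms unfolding pos_def_iff by (metis inner_zero_right less_irrefl)
  then have "invertible P" by (simp add: invertible_left_inverse matrix_left_invertible_ker)
  then have "P ** matrix_inv P = mat 1 \<and> matrix_inv P ** P = mat 1"
    unfolding invertible_def matrix_inv_def by (rule someI_ex)
  then show "P ** matrix_inv P = mat 1" "matrix_inv P ** P = mat 1" by auto
qed

lemma pos_def_inverse_vec:
  assumes "pos_def P"
  shows "P *v (matrix_inv P *v x) = x" "matrix_inv P *v (P *v x) = x"
  using pos_def_inverse[OF assms] by (simp_all add: matrix_vector_mul_assoc)

lemma selfadj_matrix_inv:
  assumes "pos_def P"
  shows "selfadj ((*v) (matrix_inv P))"
proof -
  have "(matrix_inv P *v x) \<bullet> y = x \<bullet> (matrix_inv P *v y)" for x y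
    using selfadj_inner[of "(*v) P" "matrix_inv P *v x" "matrix_inv P *v y"] assms
    by (simp add: pos_def_iff pos_def_inverse_vec[OF assms])
  then show ?thesis by (simp add: selfadj_def)
qed

lemma matrix_of_complex_linear:
  assumes "linear s" and i: "\<And>x. s (\<i> *s x) = \<i> *s s x"
  obtains M :: "complex^'n^'n" where "\<And>x. M *v x = s x"
proof -
  have "s (c *s x) = c *s s x" for c x
    using assms(1) by (subst (1 2) scalar_mult_Re_Im) (simp add: linear_add linear_scale i)
  then have "Vector_Spaces.linear (*s) (*s) s"
    using linear_add[OF assms(1)] by (simp add: Vector_Spaces.linear_iff vec.vector_space_axioms)
  from matrix_works[OF this] that show ?thesis by blast
qed

text \<open>The square root \<open>s\<close> provided by the spectral theorem is only known to be real linear. With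
  \<open>J\<close> denoting multiplication by the imaginary unit, \<open>- J s J\<close> is again a positive square root
  of \<open>P\<close>, because \<open>P\<close> commutes with \<open>J\<close> and \<open>J\<close> is orthogonal. Uniqueness of the real square root
  makes \<open>s\<close> commute with \<open>J\<close>, so \<open>s\<close> is given by a complex matrix.\<close>

lemma mat_sqrt_unique_existence:
  fixes P :: "complex^'n^'n"
  assumes P: "pos_def P"
  shows "\<exists>!S. pos_semidef S \<and> S ** S = P"
proof -
  have sa: "selfadj ((*v) P)" and nn: "\<And>x. 0 \<le> x \<bullet> (P *v x)"
    using pos_def_imp_pos_semidef[OF P] by (auto simp: pos_semidef_iff)
  obtain s where s: "selfadj s" "\<And>x. 0 \<le> x \<bullet> s x" "\<And>x. s (s x) = P *v x"
    using square_root_exists[OF sa nn] by metis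
  have lin: "linear s" using s(1) by (rule selfadj_linear)
  have P_inj: "P *v x \<noteq> 0" if "x \<noteq> 0" for x using P that by (auto simp: pos_def_iff)
  have pos: "0 < x \<bullet> s x" if "x \<noteq> 0" for x
    using P_inj[OF that] by (intro square_root_pos[OF s(1,2)]) (simp add: s(3))
  define J :: "complex^'n \<Rightarrow> complex^'n" where "J = (\<lambda>x. \<i> *s x)"
  have J: "linear J"
    unfolding J_def by (rule linearI) (simp_all add: vec_eq_iff algebra_simps)
  have JJ: "J (J x) = - x" for x by (simp add: J_def vec_eq_iff)
  have JI: "x \<bullet> J y = - (J x \<bullet> y)" for x y by (simp add: J_def inner_imaginary)
  have PJ: "P *v J x = J (P *v x)" for x by (simp add: J_def vec.scale)
  define t where "t = (\<lambda>x. - J (s (J x)))"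
  have "linear t"
    unfolding t_def by (rule linearI) (simp_all add: linear_add[OF lin] linear_add[OF J]
        linear_scale[OF lin] linear_scale[OF J])
  moreover have "t x \<bullet> y = x \<bullet> t y" for x y
  proof -
    have "t x \<bullet> y = s (J x) \<bullet> J y" by (simp add: t_def JI)
    also have "\<dots> = J x \<bullet> s (J y)" by (rule selfadj_inner[OF s(1)])
    also have "\<dots> = x \<bullet> t y" by (simp add: t_def JI)
    finally show ?thesis .
  qed
  ultimately have t: "selfadj t" by (simp add: selfadj_def)
  have t_nn: "0 \<le> x \<bullet> t x" for x
    using s(2)[of "J x"] by (simp add: t_def JI)
  have tt: "s (s x) = t (t x)" for x
    by (simp add: t_def linear_neg[OF lin] linear_neg[OF J] JJ s(3) PJ)
  have "s = t" by (rule square_root_unique[OF s(1) t pos t_nn tt])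
  then have "s (J x) = J (s x)" for x
    by (metis t_def JJ add.inverse_inverse linear_neg[OF J])
  then have "s (\<i> *s x) = \<i> *s s x" for x by (simp add: J_def)
  then obtain S where S: "\<And>x. S *v x = s x" using matrix_of_complex_linear[OF lin] by blast
  have S': "(*v) S = s" using S by auto
  show ?thesis
  proof (rule ex1I[of _ S])
    show "pos_semidef S \<and> S ** S = P"
      using s by (simp add: pos_semidef_iff S' matrix_eq matrix_vector_mul_assoc[symmetric])
  next
    fix T assume T: "pos_semidef T \<and> T ** T = P"
    have "s = (*v) T"
      using T s(3) by (intro square_root_unique[OF s(1) _ pos])
        (auto simp: pos_semidef_iff matrix_vector_mul_assoc)
    then show "T = S" using S by (simp add: matrix_eq)
  qed
qed

lemma mat_sqrt:
  assumes P: "pos_def P"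
  shows "pos_def (mat_sqrt P)" and "mat_sqrt P ** mat_sqrt P = P"
proof -
  have *: "pos_semidef (mat_sqrt P) \<and> mat_sqrt P ** mat_sqrt P = P"
    unfolding mat_sqrt_def by (rule theI'[OF mat_sqrt_unique_existence[OF P]])
  then show "mat_sqrt P ** mat_sqrt P = P" by simp
  have sa: "selfadj ((*v) (mat_sqrt P))" and nn: "\<And>x. 0 \<le> x \<bullet> (mat_sqrt P *v x)"
    using * by (auto simp: pos_semidef_iff)
  have "0 < x \<bullet> (mat_sqrt P *v x)" if "x \<noteq> 0" for x
  proof (rule square_root_pos[OF sa nn])
    show "mat_sqrt P *v (mat_sqrt P *v x) \<noteq> 0"
      using * P that by (auto simp: pos_def_iff matrix_vector_mul_assoc)
  qed
  with sa show "pos_def (mat_sqrt P)" by (simp add: pos_def_iff)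
qed

lemma form_eq_norm_sqrt:
  assumes P: "pos_def P"
  shows "x \<bullet> (P *v y) = (mat_sqrt P *v x) \<bullet> (mat_sqrt P *v y)"
  using selfadj_inner[of "(*v) (mat_sqrt P)" x "mat_sqrt P *v y"] mat_sqrt[OF P]
  by (simp add: pos_def_iff matrix_vector_mul_assoc)

text \<open>The maximal Rayleigh quotient is an eigenvalue and bounds every other one. Each eigenvalue
  belongs to a member of an orthonormal eigenbasis, so the set in \<open>lambda_max\<close> is finite and its
  maximum is meaningful.\<close>

lemma lambda_max_selfadj:
  assumes B: "selfadj ((*v) B)"
  shows "x \<bullet> (B *v x) \<le> lambda_max B * (x \<bullet> x)"
    and "\<exists>v. norm v = 1 \<and> v \<bullet> (B *v v) = lambda_max B"
proof -
  let ?L = "{l. complex_of_real l \<in> eigenvalues B}"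
  have of_real: "complex_of_real l *s v = l *\<^sub>R v" for l and v :: "complex^'n"
    by (simp add: vec_eq_iff complex_eq_iff)
  from rayleigh_eigenvector[OF B subspace_UNIV UNIV_not_zero UNIV_I] obtain v l where
    v: "norm v = 1" "B *v v = l *\<^sub>R v" and bound: "\<And>x. x \<bullet> (B *v x) \<le> l * (x \<bullet> x)"
    by (metis UNIV_I)
  obtain E where E: "finite E" "\<And>e. e \<in> E \<Longrightarrow> norm e = 1" "pairwise orthogonal E"
    "span E = UNIV" "\<And>e. e \<in> E \<Longrightarrow> \<exists>l. B *v e = l *\<^sub>R e"
    using orthonormal_eigenbasis[OF B] by metis
  then obtain m where m: "\<And>e. e \<in> E \<Longrightarrow> B *v e = m e *\<^sub>R e" by metis
  have "?L \<subseteq> m ` E"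
  proof
    fix r assume "r \<in> ?L"
    then obtain w where w: "w \<noteq> 0" "B *v w = r *\<^sub>R w" by (auto simp: eigenvalues_def of_real)
    then obtain e where e: "e \<in> E" "w \<bullet> e \<noteq> 0"
      using orthonormal_expand[OF E(1-4), of w] by (metis (no_types, lifting) scaleR_zero_left sum.neutral)
    have "r * (w \<bullet> e) = m e * (w \<bullet> e)"
      using selfadj_inner[OF B, of w e] w(2) m[OF e(1)] by simp
    then show "r \<in> m ` E" using e by simp
  qed
  then have fin: "finite ?L" using E(1) finite_surj by blast
  have "v \<noteq> 0" using v by auto
  have "l \<in> ?L" using v \<open>v \<noteq> 0\<close> by (auto simp: eigenvalues_def of_real)
  moreover have "r \<le> l" if "r \<in> ?L" for r
  proof -
    from that obtain w where w: "w \<noteq> 0" "B *v w = r *\<^sub>R w" by (auto simp: eigenvalues_def of_real)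
    from bound[of w] w show ?thesis by simp
  qed
  ultimately have "lambda_max B = l" unfolding lambda_max_def using fin by (intro Max_eqI)
  then show "x \<bullet> (B *v x) \<le> lambda_max B * (x \<bullet> x)"
    "\<exists>v. norm v = 1 \<and> v \<bullet> (B *v v) = lambda_max B"
    using bound v by (auto simp: dot_square_norm intro!: exI[of _ v])
qed

lemma hermitian_cmat: "transpose Q = Q \<Longrightarrow> hermitian (cmat Q)"
  unfolding hermitian_def cmat_def map_matrix_def transpose_def by (simp add: vec_eq_iff)

text \<open>Also used with \<open>R = 0\<close>, as the compatibility of real scaling with matrix application.\<close>

lemma scaleR_diff_matrix_vector:
  "(t *\<^sub>R P - R) *v x = t *\<^sub>R (P *v x) - R *v (x :: complex^'n)"
  by (simp add: vec_eq_iff matrix_vector_mult_def sum_subtractf scaleR_right.sum algebra_simps)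

lemma T_set_iff:
  assumes P: "pos_def P" and Q: "transpose Q = Q"
  shows "t \<in> T_set Q P \<longleftrightarrow> 0 \<le> t \<and> (\<forall>x. x \<bullet> (cmat Q *v x) \<le> t * (x \<bullet> (P *v x)))"
proof -
  have "hermitian (t *\<^sub>R P - cmat Q)"
    using P hermitian_cmat[OF Q]
    by (simp add: pos_def_iff hermitian_iff_selfadj selfadj_def scaleR_diff_matrix_vector
        inner_diff_left inner_diff_right)
  then show ?thesis
    by (simp add: T_set_def pos_semidef_def Re_cform scaleR_diff_matrix_vector inner_diff_right)
qed

text \<open>Substituting \<open>x = P\<^sup>-\<^sup>1\<^sup>/\<^sup>2 y\<close> turns \<open>x\<^sup>* Q x \<le> t x\<^sup>* P x\<close> into
  \<open>y\<^sup>* B y \<le> t y\<^sup>* y\<close> with \<open>B = P\<^sup>-\<^sup>1\<^sup>/\<^sup>2 Q P\<^sup>-\<^sup>1\<^sup>/\<^sup>2\<close>, which holds for all \<open>y\<close> exactly when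
  \<open>t\<close> is at least the largest eigenvalue of \<open>B\<close>.\<close>

lemma t_star_is_minimum:
  assumes P: "pos_def P" and Q: "transpose Q = Q"
  shows "is_minimum (T_set Q P) (t_star Q P)"
proof -
  define S where "S = mat_sqrt P"
  define R where "R = matrix_inv S"
  define B where "B = R ** cmat Q ** R"
  have S: "pos_def S" unfolding S_def by (rule mat_sqrt(1)[OF P])
  have R: "selfadj ((*v) R)" unfolding R_def by (rule selfadj_matrix_inv[OF S])
  have Qs: "selfadj ((*v) (cmat Q))" using hermitian_cmat[OF Q] by (simp add: hermitian_iff_selfadj)
  have "(B *v x) \<bullet> y = x \<bullet> (B *v y)" for x y
    unfolding B_def by (simp only: matrix_vector_mul_assoc[symmetric] selfadj_inner[OF R] selfadj_inner[OF Qs])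
  then have B: "selfadj ((*v) B)" by (simp add: selfadj_def)
  have RS: "R *v (S *v x) = x" and SR: "S *v (R *v x) = x" for x
    unfolding R_def by (rule pos_def_inverse_vec[OF S])+
  have formB: "y \<bullet> (B *v y) = (R *v y) \<bullet> (cmat Q *v (R *v y))" for y
    unfolding B_def by (simp only: matrix_vector_mul_assoc[symmetric] selfadj_inner[OF R])
  have formP: "x \<bullet> (P *v x) = (S *v x) \<bullet> (S *v x)" for x
    unfolding S_def by (rule form_eq_norm_sqrt[OF P])
  have t: "t_star Q P = max (lambda_max B) 0" by (simp add: t_star_def B_def R_def S_def)
  have "x \<bullet> (cmat Q *v x) \<le> t_star Q P * (x \<bullet> (P *v x))" for x
  proof -
    have "x \<bullet> (cmat Q *v x) \<le> lambda_max B * (x \<bullet> (P *v x))"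
      using lambda_max_selfadj(1)[OF B, of "S *v x"] by (simp add: formB formP RS)
    also have "\<dots> \<le> t_star Q P * (x \<bullet> (P *v x))"
      unfolding t formP by (intro mult_right_mono) auto
    finally show ?thesis .
  qed
  then have "t_star Q P \<in> T_set Q P" by (simp add: T_set_iff[OF P Q] t)
  moreover have "t_star Q P \<le> t" if "t \<in> T_set Q P" for t
  proof -
    obtain v where v: "norm v = 1" "v \<bullet> (B *v v) = lambda_max B"
      using lambda_max_selfadj(2)[OF B] by blast
    have "0 \<le> t" "(R *v v) \<bullet> (cmat Q *v (R *v v)) \<le> t * ((R *v v) \<bullet> (P *v (R *v v)))"
      using that by (auto simp: T_set_iff[OF P Q])
    with v show ?thesis by (simp add: t formP SR formB[symmetric] dot_square_norm)
  qed
  ultimately show ?thesis by (auto simp: is_minimum_def)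
qed

section \<open>Spectral radius below one and the existence of Lyapunov matrices\<close>

lemma matpow_Suc_right: "matpow A (Suc k) = matpow A k ** A"
  by (induction k) (simp_all add: matrix_mul_assoc)

lemma norm_complex_smult: "norm (c *s (x :: complex^'n)) = cmod c * norm x"
  by (simp add: norm_vec_def norm_mult L2_set_right_distrib)

text \<open>The vector \<open>p(B) v\<close>, evaluated by Horner's scheme.\<close>

definition poly_mat :: "complex poly \<Rightarrow> complex^'n^'n \<Rightarrow> complex^'n \<Rightarrow> complex^'n" where
  "poly_mat p B v = fold_coeffs (\<lambda>c w. c *s v + B *v w) p 0"

lemma poly_mat_0 [simp]: "poly_mat 0 B v = 0"
  by (simp add: poly_mat_def)

lemma poly_mat_pCons [simp]: "poly_mat (pCons c p) B v = c *s v + B *v poly_mat p B v"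
  by (cases "c = 0 \<and> p = 0") (auto simp: poly_mat_def)

lemma poly_mat_smult: "poly_mat (smult c p) B v = c *s poly_mat p B v"
  by (induction p) (simp_all add: vec.add vec.scale vector_add_ldistrib vector_smult_assoc)

lemma poly_mat_add: "poly_mat (p + q) B v = poly_mat p B v + poly_mat q B v"
  by (induction p q rule: poly_induct2)
    (simp_all add: vec.add vector_sadd_rdistrib algebra_simps)

lemma poly_mat_sum: "poly_mat (\<Sum>i\<in>I. f i) B v = (\<Sum>i\<in>I. poly_mat (f i) B v)"
  by (induction I rule: infinite_finite_induct) (simp_all add: poly_mat_add)

lemma poly_mat_monom: "poly_mat (monom c n) B v = c *s (matpow B n *v v)"
  by (induction n)
    (simp_all add: monom_0 monom_Suc vec.scale matrix_vector_mul_assoc[symmetric])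

lemma poly_mat_linear_factor:
  "poly_mat ([:-l, 1:] * p) B v = B *v poly_mat p B v - l *s poly_mat p B v"
proof -
  have "[:-l, 1:] * p = smult (-l) p + pCons 0 p" by simp
  then show ?thesis by (simp only: poly_mat_add poly_mat_smult poly_mat_pCons) (simp add: vec_eq_iff)
qed

lemma poly_mat_commute:
  "poly_mat p B (B *v v - l *s v) = B *v poly_mat p B v - l *s poly_mat p B v"
  by (induction p) (simp_all add: vec.add vec.diff vec.scale)

lemma poly_mat_eigenvector:
  "B *v v = l *s v \<Longrightarrow> poly_mat p B v = poly p l *s v"
  by (induction p) (simp_all add: vec.scale algebra_simps)

text \<open>A family indexed by numbers may repeat vectors, and then its range can well be independent;
  in that case a repetition itself gives the dependence.\<close>

lemma sequence_linear_dependence: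
  fixes f :: "nat \<Rightarrow> 'a::euclidean_space"
  obtains c :: "nat \<Rightarrow> real" and N j where "(\<Sum>i<N. c i *\<^sub>R f i) = 0" "j < N" "c j \<noteq> 0"
proof (cases "inj_on f {..<Suc DIM('a)}")
  case True
  let ?N = "Suc DIM('a)"
  have "card (f ` {..<?N}) = ?N" using True by (simp add: card_image)
  then have "dependent (f ` {..<?N})"
    using independent_bound[of "f ` {..<?N}"] by fastforce
  then obtain u v where u: "v \<in> f ` {..<?N}" "u v \<noteq> 0" "(\<Sum>v\<in>f ` {..<?N}. u v *\<^sub>R v) = 0"
    by (auto simp: dependent_finite)
  then have "(\<Sum>i<?N. u (f i) *\<^sub>R f i) = 0" by (simp only: sum.reindex[OF True] o_def)
  with u that[of "\<lambda>i. u (f i)" ?N] show ?thesis by auto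
next
  case False
  then obtain i j where ij: "i < Suc DIM('a)" "j < Suc DIM('a)" "i \<noteq> j" "f i = f j"
    by (auto simp: inj_on_def)
  define c where "c k = (if k = i then 1 else if k = j then -1 else 0 :: real)" for k
  have "(\<Sum>k<Suc DIM('a). c k *\<^sub>R f k) = (\<Sum>k\<in>{i, j}. c k *\<^sub>R f k)"
    using ij by (intro sum.mono_neutral_right) (auto simp: c_def)
  also have "\<dots> = 0" using ij by (simp add: c_def)
  finally show ?thesis using ij that[of c "Suc DIM('a)" i] by (simp add: c_def)
qed

text \<open>The powers of \<open>B\<close> live in a finite-dimensional space of matrices, hence they are dependent.\<close>

lemma annihilating_polynomial:
  obtains p where "p \<noteq> 0" "\<And>v. poly_mat p B v = 0"
proof -
  obtain c N j where c: "(\<Sum>i<N. c i *\<^sub>R matpow B i) = 0" "j < N" "c j \<noteq> 0"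
    using sequence_linear_dependence[of "matpow B"] .
  define p where "p = (\<Sum>i<N. monom (complex_of_real (c i)) i)"
  have "coeff p j = complex_of_real (c j)" using c(2) by (simp add: p_def coeff_sum)
  then have "p \<noteq> 0" using c(3) by auto
  moreover have "poly_mat p B v = 0" for v
  proof -
    have lin: "linear (\<lambda>M. M *v v)"
      by (rule linearI) (simp_all add: vec_eq_iff matrix_vector_mult_def sum.distrib algebra_simps
          scaleR_right.sum)
    have "(\<Sum>i<N. c i *\<^sub>R matpow B i) *v v = (\<Sum>i<N. c i *\<^sub>R (matpow B i *v v))"
      by (simp only: linear_sum[OF lin] linear_scale[OF lin])
    also have "\<dots> = poly_mat p B v"
      unfolding p_def poly_mat_sum poly_mat_monom
      by (intro sum.cong refl) (simp add: vec_eq_iff complex_eq_iff)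
    finally show ?thesis by (simp add: c)
  qed
  ultimately show ?thesis by (rule that)
qed

text \<open>This makes the maximum in \<open>spectral_radius\<close> an upper bound for the moduli of all eigenvalues.\<close>

lemma finite_eigenvalues: "finite (eigenvalues B)"
proof -
  obtain p where p: "p \<noteq> 0" "\<And>v. poly_mat p B v = 0" using annihilating_polynomial[of B] by blast
  have "eigenvalues B \<subseteq> {z. poly p z = 0}"
  proof
    fix l assume "l \<in> eigenvalues B"
    then obtain v where "v \<noteq> 0" "B *v v = l *s v" by (auto simp: eigenvalues_def)
    then show "l \<in> {z. poly p z = 0}" using p(2) poly_mat_eigenvector[of B v l p] by (auto simp: vec_eq_iff)
  qed
  then show ?thesis using poly_roots_finite[OF p(1)] finite_subset by blast
qed

text \<open>Summing the recursion bounds a partial sum \<open>S\<close> by \<open>a 0 + c S + suminf e\<close>, and \<open>c < 1\<close> lets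
  the term \<open>c S\<close> be absorbed.\<close>

lemma summable_of_contraction:
  fixes a e :: "nat \<Rightarrow> real"
  assumes a: "\<And>k. 0 \<le> a k" and e: "\<And>k. 0 \<le> e k" "summable e" and c: "0 \<le> c" "c < 1"
    and rec: "\<And>k. a (Suc k) \<le> c * a k + e k"
  shows "summable a"
proof (rule summableI_nonneg_bounded[OF a])
  fix n
  have "(\<Sum>k<n. a k) \<le> (\<Sum>k<Suc n. a k)" using a by simp
  also have "\<dots> = a 0 + (\<Sum>k<n. a (Suc k))" by (rule sum.lessThan_Suc_shift)
  also have "\<dots> \<le> a 0 + (\<Sum>k<n. c * a k + e k)" by (intro add_left_mono sum_mono rec)
  also have "\<dots> = a 0 + c * (\<Sum>k<n. a k) + (\<Sum>k<n. e k)"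
    by (simp add: sum.distrib sum_distrib_left)
  also have "\<dots> \<le> a 0 + c * (\<Sum>k<n. a k) + suminf e"
    using sum_le_suminf[OF e(2), of "{..<n}"] e(1) by simp
  finally have "(1 - c) * (\<Sum>k<n. a k) \<le> a 0 + suminf e" by (simp add: algebra_simps)
  then show "(\<Sum>k<n. a k) \<le> (a 0 + suminf e) / (1 - c)"
    using c by (simp add: pos_le_divide_eq mult.commute)
qed

text \<open>Induction on the degree of the annihilating polynomial \<open>p = (z - l) r\<close>. Either \<open>r\<close> already
  annihilates \<open>v\<close>, or \<open>r(B) v\<close> is an eigenvector for \<open>l\<close>, so that \<open>cmod l < 1\<close>. In the second case
  \<open>u = B v - l v\<close> is annihilated by \<open>r\<close> and thus has a summable orbit, and the orbit of \<open>v\<close> follows the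
  contracting recursion \<open>B\<^sup>k\<^sup>+\<^sup>1 v = l B\<^sup>k v + B\<^sup>k u\<close>. This replaces the Jordan normal form.\<close>

lemma summable_orbit_of_annihilated:
  assumes B: "\<And>l. l \<in> eigenvalues B \<Longrightarrow> cmod l < 1"
    and "p \<noteq> 0" "poly_mat p B v = 0"
  shows "summable (\<lambda>k. norm (matpow B k *v v))"
  using assms(2,3)
proof (induction "degree p" arbitrary: p v rule: less_induct)
  case less
  show ?case
  proof (cases "degree p = 0")
    case True
    then obtain c where "p = [:c:]" by (rule degree_eq_zeroE)
    then have "v = 0" using less.prems by (simp add: vec_eq_iff)
    then show ?thesis by simp
  next
    case False
    then have "\<not> constant (poly p)" by (simp add: constant_degree)
    then obtain l where "poly p l = 0" using fundamental_theorem_of_algebra by blast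
    then obtain r where r: "p = [:-l, 1:] * r" by (auto simp: poly_eq_0_iff_dvd)
    then have "r \<noteq> 0" using less.prems by auto
    have "degree r < degree p" unfolding r using \<open>r \<noteq> 0\<close> by (subst degree_mult_eq) auto
    note IH = less.hyps[OF this \<open>r \<noteq> 0\<close>]
    have w: "B *v poly_mat r B v - l *s poly_mat r B v = 0"
      using less.prems(2) unfolding r poly_mat_linear_factor .
    show ?thesis
    proof (cases "poly_mat r B v = 0")
      case True
      then show ?thesis by (rule IH)
    next
      case False
      then have "l \<in> eigenvalues B" using w by (auto simp: eigenvalues_def)
      then have l: "cmod l < 1" by (rule B)
      define u where "u = B *v v - l *s v"
      have "poly_mat r B u = 0" unfolding u_def poly_mat_commute by (rule w)
      then have u: "summable (\<lambda>k. norm (matpow B k *v u))" by (rule IH)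
      have rec: "norm (matpow B (Suc k) *v v) \<le> cmod l * norm (matpow B k *v v) + norm (matpow B k *v u)"
        for k
      proof -
        have "matpow B (Suc k) *v v = matpow B k *v (l *s v + u)"
          by (simp add: matpow_Suc_right u_def matrix_vector_mul_assoc[symmetric] del: matpow.simps)
        also have "\<dots> = l *s (matpow B k *v v) + matpow B k *v u" by (simp add: vec.add vec.scale)
        finally show ?thesis by (metis norm_complex_smult norm_triangle_ineq)
      qed
      show ?thesis
        by (rule summable_of_contraction[OF norm_ge_zero norm_ge_zero u norm_ge_zero l rec])
    qed
  qed
qed

lemma summable_orbit:
  assumes "spectral_radius A < 1"
  shows "summable (\<lambda>k. norm (matpow (cmat A) k *v v))"
proof -
  have "cmod l < 1" if "l \<in> eigenvalues (cmat A)" for l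
    using assms that finite_eigenvalues[of "cmat A"] unfolding spectral_radius_def
    by (meson Max_ge finite_imageI imageI le_less_trans)
  moreover obtain p where "p \<noteq> 0" "\<And>v. poly_mat p (cmat A) v = 0"
    using annihilating_polynomial[of "cmat A"] by blast
  ultimately show ?thesis by (intro summable_orbit_of_annihilated)
qed

text \<open>The only eigenvalue of the zero matrix is zero.\<close>

lemma spectral_radius_pos_nonzero:
  assumes "0 < spectral_radius A"
  obtains x where "cmat A *v x \<noteq> 0"
proof (rule ccontr)
  assume "\<not> thesis"
  then have z: "cmat A *v x = 0" for x using that by blast
  obtain v :: "complex^'a" where "v \<noteq> 0" using UNIV_not_zero by blast
  then have "eigenvalues (cmat A) = {0}"
    unfolding eigenvalues_def z by (auto simp: vec_eq_iff)
  then show False using assms by (simp add: spectral_radius_def)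
qed

lemma cmat_transpose_adjoint: "(cmat (transpose A) *v x) \<bullet> y = x \<bullet> (cmat A *v y)"
proof -
  have "(\<Sum>i\<in>UNIV. cnj ((cmat (transpose A) *v x) $ i) * y $ i)
      = (\<Sum>i\<in>UNIV. \<Sum>j\<in>UNIV. cnj (x $ j) * (complex_of_real (A $ j $ i) * y $ i))"
    by (simp add: matrix_vector_mult_def cmat_def map_matrix_def transpose_def sum_distrib_left mult_ac)
  also have "\<dots> = (\<Sum>j\<in>UNIV. \<Sum>i\<in>UNIV. cnj (x $ j) * (complex_of_real (A $ j $ i) * y $ i))"
    by (rule sum.swap)
  also have "\<dots> = (\<Sum>j\<in>UNIV. cnj (x $ j) * (cmat A *v y) $ j)"
    by (simp add: matrix_vector_mult_def cmat_def map_matrix_def sum_distrib_left)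
  finally show ?thesis by (simp only: inner_eq_Re)
qed

lemma matpow_adjoint:
  assumes "\<And>x y. (C *v x) \<bullet> y = x \<bullet> (B *v y)"
  shows "(matpow C k *v x) \<bullet> y = x \<bullet> (matpow B k *v y)"
proof (induction k arbitrary: x y)
  case (Suc k)
  have "(matpow C (Suc k) *v x) \<bullet> y = (C *v (matpow C k *v x)) \<bullet> y"
    by (simp add: matrix_vector_mul_assoc)
  also have "\<dots> = x \<bullet> (matpow B k *v (B *v y))" by (simp add: assms Suc)
  also have "\<dots> = x \<bullet> (matpow B (Suc k) *v y)"
    by (simp add: matpow_Suc_right matrix_vector_mul_assoc del: matpow.simps)
  finally show ?case .
qed simp

lemma summable_euclidean_componentwise:
  fixes f :: "nat \<Rightarrow> 'a::euclidean_space"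
  assumes "\<And>b. b \<in> Basis \<Longrightarrow> summable (\<lambda>k. f k \<bullet> b)"
  shows "summable f"
proof -
  have "summable (\<lambda>k. \<Sum>b\<in>Basis. (f k \<bullet> b) *\<^sub>R b)"
    using assms by (intro summable_sum summable_scaleR_left)
  then show ?thesis by (simp add: euclidean_representation)
qed

lemma summable_inner:
  fixes f g :: "nat \<Rightarrow> 'a::real_inner"
  assumes f: "summable (\<lambda>k. norm (f k))" and g: "summable (\<lambda>k. norm (g k))"
  shows "summable (\<lambda>k. f k \<bullet> g k)"
proof -
  have "(\<lambda>k. norm (g k)) \<longlonglongrightarrow> 0" using g by (rule summable_LIMSEQ_zero)
  then have "Bseq (\<lambda>k. norm (g k))" by (rule convergent_imp_Bseq[OF convergentI])
  then obtain K where K: "\<And>k. norm (norm (g k)) \<le> K" unfolding Bseq_def by blast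
  show ?thesis
  proof (rule summable_comparison_test'[of "\<lambda>k. norm (f k) * K" 0])
    show "summable (\<lambda>k. norm (f k) * K)" using f by (rule summable_mult2)
    show "norm (f k \<bullet> g k) \<le> norm (f k) * K" for k
      using Cauchy_Schwarz_ineq2[of "f k" "g k"] K[of k]
      by (smt (verit) mult_left_mono norm_ge_zero real_norm_def)
  qed
qed

text \<open>The Gram series \<open>P = (\<Sum>k. (A\<^sup>k)\<^sup>T A\<^sup>k)\<close> converges because orbits are summable, its form is
  \<open>x\<^sup>* P x = (\<Sum>k. (norm (A\<^sup>k x))\<^sup>2)\<close>, and shifting the series by one index gives
  \<open>P - A\<^sup>T P A = I\<close>.\<close>

lemma lyap_nonempty:
  fixes A :: "real^'n^'n"
  assumes "spectral_radius A < 1"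
  shows "lyap A \<noteq> {}"
proof -
  define B where "B = cmat A"
  define C where "C = cmat (transpose A)"
  define G where "G k = matpow C k ** matpow B k" for k
  have adj: "(C *v x) \<bullet> y = x \<bullet> (B *v y)" for x y
    unfolding B_def C_def by (rule cmat_transpose_adjoint)
  have orbit: "summable (\<lambda>k. norm (matpow B k *v x))" for x
    unfolding B_def by (rule summable_orbit[OF assms])
  have formG: "x \<bullet> (G k *v y) = (matpow B k *v x) \<bullet> (matpow B k *v y)" for x y k
    unfolding G_def matrix_vector_mul_assoc[symmetric]
    by (metis matpow_adjoint[OF adj] inner_commute)
  have sumG: "summable (\<lambda>k. x \<bullet> (G k *v y))" for x y
    unfolding formG by (intro summable_inner orbit)
  have "summable G"
  proof (rule summable_euclidean_componentwise)
    fix b :: "complex^'n^'n" assume "b \<in> Basis"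
    then obtain i j c where b: "b = axis i (axis j c)" by (auto simp: Basis_vec_def)
    have "G k \<bullet> b = axis i 1 \<bullet> (G k *v axis j (cnj c))" for k
      by (simp add: b inner_axis inner_axis' matrix_vector_axis inner_complex_def)
    then show "summable (\<lambda>k. G k \<bullet> b)" using sumG by simp
  qed
  then have G: "G sums suminf G" by (rule summable_sums)
  define P where "P = suminf G"
  have formP: "(\<lambda>k. x \<bullet> (G k *v y)) sums (x \<bullet> (P *v y))" for x y
  proof -
    have "linear (\<lambda>M. x \<bullet> (M *v y))"
      by (rule linearI) (simp_all add: matrix_vector_mult_add_rdistrib inner_add_right
          scaleR_diff_matrix_vector[of _ _ 0, simplified])
    then have "bounded_linear (\<lambda>M. x \<bullet> (M *v y))" by (simp add: linear_conv_bounded_linear)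
    from bounded_linear.sums[OF this G] show ?thesis by (simp only: P_def)
  qed
  have "(P *v x) \<bullet> y = x \<bullet> (P *v y)" for x y
    using formP[of x y] formP[of y x] unfolding formG
    by (metis (no_types, lifting) inner_commute sums_cong sums_unique2)
  moreover have "0 < x \<bullet> (P *v x)" if "x \<noteq> 0" for x
  proof -
    have "0 < (\<Sum>k. x \<bullet> (G k *v x))"
      using that sumG by (subst suminf_pos_iff) (auto simp: formG intro!: exI[of _ 0])
    then show ?thesis using sums_unique[OF formP[of x x]] by simp
  qed
  ultimately have "pos_def P" by (simp add: pos_def_iff selfadj_def)
  moreover have "P - C ** P ** B = mat 1"
  proof -
    have "linear (\<lambda>M. C ** M ** B)"
      by (rule linearI) (simp_all add: matrix_add_ldistrib matrix_eq matrix_vector_mul_assoc[symmetric]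
          matrix_vector_mult_add_rdistrib vec.add scaleR_diff_matrix_vector[of _ _ 0, simplified]
          linear_scale[OF matrix_vector_mul_linear])
    then have "bounded_linear (\<lambda>M. C ** M ** B)" by (simp add: linear_conv_bounded_linear)
    from bounded_linear.sums[OF this G] have "(\<lambda>k. C ** G k ** B) sums (C ** P ** B)"
      by (simp only: P_def)
    moreover have "C ** G k ** B = G (Suc k)" for k
      unfolding G_def matpow_Suc_right[of B k] by (simp add: matrix_mul_assoc)
    ultimately have "(\<lambda>k. G (Suc k)) sums (C ** P ** B)" by simp
    then have "G sums (C ** P ** B + G 0)" by (rule sums_Suc_iff[THEN iffD1])
    then have "P = C ** P ** B + G 0" using G unfolding P_def by (rule sums_unique2[rotated])
    then show ?thesis by (simp add: G_def algebra_simps)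
  qed
  moreover have "pos_def (mat 1 :: complex^'n^'n)"
    unfolding pos_def_iff selfadj_def by simp
  ultimately have "P \<in> lyap A" by (simp add: lyap_def B_def C_def)
  then show ?thesis by blast
qed

section \<open>The Lyapunov envelope\<close>

lemma pos_def_lower_bound:
  assumes "pos_def M"
  obtains e where "0 < e" "\<And>x. e * (x \<bullet> x) \<le> x \<bullet> (M *v x)"
proof -
  have "selfadj (\<lambda>x. - (M *v x))"
    using assms by (auto simp: pos_def_iff selfadj_def intro!: linear_compose_neg)
  from rayleigh_eigenvector[OF this subspace_UNIV UNIV_not_zero UNIV_I]
  obtain v l where v: "norm v = 1" "- (M *v v) = l *\<^sub>R v"
    and bound: "\<And>x. x \<bullet> - (M *v x) \<le> l * (x \<bullet> x)"
    by (metis UNIV_I)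
  have "v \<bullet> (M *v v) = - l"
    using v by (metis inner_minus_right inner_scaleR_right add.inverse_inverse dot_square_norm
        mult_1_right one_power2)
  then have "0 < - l" using assms v(1) by (metis norm_zero pos_def_iff zero_neq_one)
  moreover have "- l * (x \<bullet> x) \<le> x \<bullet> (M *v x)" for x using bound[of x] by simp
  ultimately show ?thesis by (rule that)
qed

lemma pos_def_upper_bound:
  assumes "pos_def M"
  obtains c where "0 < c" "\<And>x. x \<bullet> (M *v x) \<le> c * (x \<bullet> x)"
proof -
  have "selfadj ((*v) M)" using assms by (simp add: pos_def_iff)
  from rayleigh_eigenvector[OF this subspace_UNIV UNIV_not_zero UNIV_I]
  obtain v l where v: "norm v = 1" "M *v v = l *\<^sub>R v"
    and bound: "\<And>x. x \<bullet> (M *v x) \<le> l * (x \<bullet> x)"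
    by (metis UNIV_I)
  have "v \<bullet> (M *v v) = l" using v by (simp add: dot_square_norm)
  then have "0 < l" using assms v(1) by (metis norm_zero pos_def_iff zero_neq_one)
  then show ?thesis using bound that by blast
qed

lemma norm_P_eq:
  assumes "pos_def P"
  shows "norm_P P x = norm (mat_sqrt P *v x)"
  by (simp add: norm_P_def Re_cform form_eq_norm_sqrt[OF assms] norm_eq_sqrt_inner)

lemma norm_P_power2: "pos_def P \<Longrightarrow> (norm_P P x)\<^sup>2 = x \<bullet> (P *v x)"
  by (simp add: norm_P_eq form_eq_norm_sqrt power2_norm_eq_inner)

lemma norm_P_pos: "pos_def P \<Longrightarrow> x \<noteq> 0 \<Longrightarrow> 0 < norm_P P x"
  by (simp add: norm_P_def Re_cform pos_def_iff)

lemma norm_P_nonneg: "pos_def P \<Longrightarrow> 0 \<le> norm_P P x"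
  by (simp add: norm_P_eq)

text \<open>The decrease \<open>x\<^sup>* P x - (A x)\<^sup>* P (A x)\<close> is a positive definite form, hence it dominates a fixed
  fraction of \<open>x\<^sup>* P x\<close>.\<close>

lemma lyap_contraction:
  assumes P: "P \<in> lyap A"
  obtains c where "c < 1" "\<And>x. norm_P P (cmat A *v x) \<le> c * norm_P P x"
proof -
  define D where "D = P - cmat (transpose A) ** P ** cmat A"
  have P': "pos_def P" and D: "pos_def D" using P by (auto simp: lyap_def D_def)
  obtain e where e: "0 < e" "\<And>x. e * (x \<bullet> x) \<le> x \<bullet> (D *v x)" using pos_def_lower_bound[OF D] by blast
  obtain K where K: "0 < K" "\<And>x. x \<bullet> (P *v x) \<le> K * (x \<bullet> x)" using pos_def_upper_bound[OF P'] by blast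
  define r where "r = max 0 (1 - e / K)"
  have bound: "(norm_P P (cmat A *v x))\<^sup>2 \<le> r * (norm_P P x)\<^sup>2" for x
  proof -
    have "x \<bullet> (D *v x) = x \<bullet> (P *v x) - (cmat A *v x) \<bullet> (P *v (cmat A *v x))"
      unfolding D_def using cmat_transpose_adjoint[of A "P *v (cmat A *v x)" x]
      by (simp add: matrix_vector_mult_diff_rdistrib inner_diff_right matrix_vector_mul_assoc[symmetric]
          inner_commute)
    then have "(norm_P P (cmat A *v x))\<^sup>2 \<le> (norm_P P x)\<^sup>2 - e * (x \<bullet> x)"
      using e(2)[of x] by (simp add: norm_P_power2[OF P'])
    also have "\<dots> \<le> (norm_P P x)\<^sup>2 - e / K * (norm_P P x)\<^sup>2"
      using mult_left_mono[OF K(2)[of x], of "e / K"] e(1) K(1) by (simp add: norm_P_power2[OF P'])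
    also have "\<dots> = (1 - e / K) * (norm_P P x)\<^sup>2" by (simp add: algebra_simps)
    also have "\<dots> \<le> r * (norm_P P x)\<^sup>2" unfolding r_def by (intro mult_right_mono) auto
    finally show ?thesis .
  qed
  have "norm_P P (cmat A *v x) \<le> sqrt r * norm_P P x" for x
    using real_sqrt_le_mono[OF bound[of x]] norm_P_nonneg[OF P']
    by (simp add: real_sqrt_mult)
  moreover have "sqrt r < 1" using e(1) K(1) by (simp add: r_def)
  ultimately show ?thesis using that by blast
qed

text \<open>The contraction constant bounds the quotients whose supremum defines \<open>opnorm_P\<close>, so the
  supremum is both an honest upper bound and smaller than one.\<close>

lemma
  assumes P: "P \<in> lyap A"
  shows opnorm_P_bound: "norm_P P (cmat A *v x) \<le> opnorm_P P A * norm_P P x"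
    and opnorm_P_less_1: "opnorm_P P A < 1"
proof -
  have P': "pos_def P" using P by (simp add: lyap_def)
  obtain c where c: "c < 1" "\<And>x. norm_P P (cmat A *v x) \<le> c * norm_P P x"
    using lyap_contraction[OF P] by blast
  have ratio: "norm_P P (cmat A *v x) / norm_P P x \<le> c" if "x \<noteq> 0" for x
    using c(2)[of x] norm_P_pos[OF P' that] by (simp add: pos_divide_le_eq)
  obtain z :: "complex^'a" where "z \<noteq> 0" using UNIV_not_zero by blast
  then have "opnorm_P P A \<le> c"
    unfolding opnorm_P_def using ratio by (intro cSUP_least) auto
  then show "opnorm_P P A < 1" using c(1) by simp
  show "norm_P P (cmat A *v x) \<le> opnorm_P P A * norm_P P x"
  proof (cases "x = 0")
    case True
    then show ?thesis by (simp add: norm_P_eq[OF P'])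
  next
    case False
    have "norm_P P (cmat A *v x) / norm_P P x \<le> opnorm_P P A"
      unfolding opnorm_P_def using False ratio
      by (intro cSUP_upper bdd_aboveI[where M=c]) auto
    then show ?thesis using norm_P_pos[OF P' False] by (simp add: pos_divide_le_eq)
  qed
qed

lemma opnorm_P_pos:
  assumes P: "P \<in> lyap A" and A: "0 < spectral_radius A"
  shows "0 < opnorm_P P A"
proof -
  have P': "pos_def P" using P by (simp add: lyap_def)
  obtain x where x: "cmat A *v x \<noteq> 0" using spectral_radius_pos_nonzero[OF A] .
  have "0 < norm_P P (cmat A *v x)" by (rule norm_P_pos[OF P' x])
  also have "\<dots> \<le> opnorm_P P A * norm_P P x" by (rule opnorm_P_bound[OF P])
  finally show ?thesis
    using norm_P_nonneg[OF P', of x] by (metis less_le_not_le mult_le_0_iff not_le)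
qed

lemma opnorm_P_matpow_bound:
  assumes P: "P \<in> lyap A" and A: "0 < spectral_radius A"
  shows "norm_P P (matpow (cmat A) k *v x) \<le> opnorm_P P A ^ k * norm_P P x"
proof (induction k)
  case (Suc k)
  have "norm_P P (matpow (cmat A) (Suc k) *v x) \<le> opnorm_P P A * norm_P P (matpow (cmat A) k *v x)"
    using opnorm_P_bound[OF P] by (simp add: matrix_vector_mul_assoc[symmetric])
  also have "\<dots> \<le> opnorm_P P A * (opnorm_P P A ^ k * norm_P P x)"
    using opnorm_P_pos[OF P A] Suc by (intro mult_left_mono) auto
  finally show ?case by (simp add: mult.assoc)
qed simp

lemma dual_norm_P_eq:
  assumes P: "pos_def P"
  shows "dual_norm_P P y = norm_P P (matrix_inv P *v y)"
  by (simp add: dual_norm_P_def norm_P_def Re_cform pos_def_inverse_vec[OF P] inner_commute)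

lemma dual_norm_P_nonneg: "pos_def P \<Longrightarrow> 0 \<le> dual_norm_P P y"
  by (simp add: dual_norm_P_eq norm_P_nonneg)

lemma dual_norm_P_pos: "pos_def P \<Longrightarrow> y \<noteq> 0 \<Longrightarrow> 0 < dual_norm_P P y"
  by (metis dual_norm_P_eq matrix_vector_mult_0_right norm_P_pos pos_def_inverse_vec(1))

text \<open>With \<open>y = P z\<close> this is the Cauchy-Schwarz inequality for \<open>P\<^sup>1\<^sup>/\<^sup>2 z\<close> and \<open>P\<^sup>1\<^sup>/\<^sup>2 x\<close>.\<close>

lemma dual_norm_P_Cauchy_Schwarz:
  assumes P: "pos_def P"
  shows "y \<bullet> x \<le> dual_norm_P P y * norm_P P x"
proof -
  define z where "z = matrix_inv P *v y"
  have "y = P *v z" unfolding z_def by (simp add: pos_def_inverse_vec[OF P])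
  then have "y \<bullet> x = (mat_sqrt P *v z) \<bullet> (mat_sqrt P *v x)"
    by (metis form_eq_norm_sqrt[OF P] inner_commute)
  also have "\<dots> \<le> norm_P P z * norm_P P x"
    unfolding norm_P_eq[OF P] by (rule norm_cauchy_schwarz)
  finally show ?thesis by (simp add: dual_norm_P_eq[OF P] z_def)
qed

lemma cvec_mult: "cvec (A *v x) = cmat A *v cvec x"
  by (simp add: cvec_def cmat_def map_matrix_def matrix_vector_mult_def vec_eq_iff)

lemma cvec_matpow: "cvec (matpow A k *v x) = matpow (cmat A) k *v cvec x"
  by (induction k) (simp_all add: matrix_vector_mul_assoc[symmetric] cvec_mult)

lemma inner_cvec: "cvec x \<bullet> cvec y = x \<bullet> y"
  by (simp add: cvec_def inner_vec_def inner_complex_def)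

lemma cvec_eq_0_iff: "cvec x = 0 \<longleftrightarrow> x = 0"
  by (simp add: cvec_def vec_eq_iff)

lemma norm_P_le_sqrt_mu:
  assumes "compact X" "x \<in> X"
  shows "norm_P P (cvec x) \<le> sqrt (mu X P)"
proof -
  have "continuous_on X (\<lambda>x. Re (cform P (cvec x)))"
    unfolding cform_def cvec_def matrix_vector_mult_def by (intro continuous_intros)
  then have "bdd_above ((\<lambda>x. Re (cform P (cvec x))) ` X)"
    using assms(1) by (intro bounded_imp_bdd_above compact_imp_bounded compact_continuous_image)
  then have "Re (cform P (cvec x)) \<le> mu X P"
    unfolding mu_def using assms(2) by (intro cSUP_upper)
  then show ?thesis by (simp add: norm_P_def)
qed

lemma mu_pos:
  assumes P: "pos_def P" and X: "compact X" "X \<noteq> {}" "X \<noteq> {0}"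
  shows "0 < mu X P"
proof -
  obtain x where x: "x \<in> X" "x \<noteq> 0" using X by blast
  have "0 < norm_P P (cvec x)" using P x by (intro norm_P_pos) (auto simp: cvec_eq_0_iff)
  also have "\<dots> \<le> sqrt (mu X P)" by (rule norm_P_le_sqrt_mu[OF X(1) x(1)])
  finally show ?thesis by simp
qed

text \<open>Completing the square backwards: both branches of the definition are the same quadratic
  polynomial, from which monotonicity in \<open>t\<close> and in \<open>x\<close> can be read off.\<close>

lemma H_eq:
  assumes "0 \<le> t" "0 < mu X P"
  shows "H q X P t x = t * mu X P * x\<^sup>2 + sqrt (mu X P) * dual_norm_P P (cvec q) * x"
proof (cases "t = 0")
  case False
  then have t: "0 < t" using assms by simp
  let ?c = "dual_norm_P P (cvec q)"
  have "(sqrt (t * mu X P) * x + ?c / (2 * sqrt t))\<^sup>2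
      = (sqrt (t * mu X P))\<^sup>2 * x\<^sup>2 + 2 * (sqrt (t * mu X P) * x) * (?c / (2 * sqrt t))
        + ?c\<^sup>2 / (4 * (sqrt t)\<^sup>2)"
    by (simp add: power2_sum power_mult_distrib power_divide)
  also have "\<dots> = t * mu X P * x\<^sup>2 + sqrt (mu X P) * ?c * x + ?c\<^sup>2 / (4 * t)"
    using t assms(2) by (simp add: real_sqrt_mult power_mult_distrib)
  finally show ?thesis using t by (simp add: H_def)
qed (simp add: H_def)

lemma H_mono_t:
  assumes "0 \<le> s" "s \<le> t" "0 < mu X P"
  shows "H q X P s x \<le> H q X P t x"
  using assms by (simp add: H_eq mult_right_mono)

text \<open>For \<open>t > 0\<close> the quadratic coefficient is positive. If \<open>t = 0\<close> is admissible then \<open>Q\<close> is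
  negative semidefinite, so \<open>q \<noteq> 0\<close> and the linear coefficient is positive.\<close>

lemma H_strict_mono:
  assumes P: "pos_def P" and X: "compact X" "X \<noteq> {}" "X \<noteq> {0}"
    and t: "t \<in> T_set Q P" and q: "pos_semidef (- cmat Q) \<longrightarrow> q \<noteq> 0"
  shows "strict_mono_on {0..} (H q X P t)"
proof (rule strict_mono_onI)
  fix x y :: real assume "x \<in> {0..}" "y \<in> {0..}" "x < y"
  then have xy: "0 \<le> x" "x < y" by auto
  have mu: "0 < mu X P" by (rule mu_pos[OF P X])
  have t0: "0 \<le> t" using t by (simp add: T_set_def)
  let ?a = "t * mu X P" and ?b = "sqrt (mu X P) * dual_norm_P P (cvec q)"
  have a: "0 \<le> ?a" and b: "0 \<le> ?b" using t0 mu dual_norm_P_nonneg[OF P] by auto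
  have sq: "x\<^sup>2 < y\<^sup>2" using xy by (simp add: power_strict_mono)
  have "0 < ?a \<or> 0 < ?b"
  proof (cases "t = 0")
    case True
    then have "pos_semidef (- cmat Q)" using t by (simp add: T_set_def)
    then have "cvec q \<noteq> 0" using q by (simp add: cvec_eq_0_iff)
    then show ?thesis using mu dual_norm_P_pos[OF P] by simp
  qed (use t0 mu in simp)
  then have "?a * x\<^sup>2 + ?b * x < ?a * y\<^sup>2 + ?b * y"
    using xy sq a b
    by (metis (no_types, lifting) add_le_less_mono add_less_le_mono less_imp_le mult_left_mono
        mult_strict_left_mono)
  then show "H q X P t x < H q X P t y" by (simp add: H_eq[OF t0 mu])
qed

text \<open>With \<open>y = A\<^sup>j x\<close>, the quadratic part of the objective is at most \<open>t\<close> times the squared norm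
  of \<open>y\<close> since \<open>t P - Q\<close> is positive semidefinite, the linear part is at most the dual norm of \<open>q\<close>
  times the norm of \<open>y\<close>, and this norm has shrunk by the factor \<open>opnorm_P P A ^ j\<close>.\<close>

lemma nu_le_H:
  fixes A Q :: "real^'n^'n"
  assumes P: "P \<in> lyap A" and A: "0 < spectral_radius A" and Q: "transpose Q = Q"
    and X: "compact X" "X \<noteq> {}" "X \<noteq> {0}" and t: "t \<in> T_set Q P"
  shows "nu A Q q X j \<le> H q X P t (opnorm_P P A ^ j)"
  unfolding nu_def
proof (rule cSUP_least[OF X(2)])
  fix x assume x: "x \<in> X"
  have P': "pos_def P" using P by (simp add: lyap_def)
  have mu: "0 < mu X P" by (rule mu_pos[OF P' X])
  have t': "0 \<le> t" "\<And>x. x \<bullet> (cmat Q *v x) \<le> t * (x \<bullet> (P *v x))"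
    using t by (auto simp: T_set_iff[OF P' Q])
  define a where "a = opnorm_P P A ^ j"
  define y where "y = matpow A j *v x"
  have "norm_P P (cvec y) \<le> a * norm_P P (cvec x)"
    unfolding y_def a_def cvec_matpow by (rule opnorm_P_matpow_bound[OF P A])
  also have "\<dots> \<le> a * sqrt (mu X P)"
    using opnorm_P_pos[OF P A] norm_P_le_sqrt_mu[OF X(1) x]
    by (intro mult_left_mono) (auto simp: a_def)
  finally have ny: "norm_P P (cvec y) \<le> a * sqrt (mu X P)" .
  have "x \<bullet> ((transpose (matpow A j) ** Q ** matpow A j) *v x) = y \<bullet> (Q *v y)"
    unfolding y_def matrix_vector_mul_assoc[symmetric]
    by (metis dot_lmul_matrix inner_commute transpose_matrix_vector)
  also have "\<dots> = cvec y \<bullet> (cmat Q *v cvec y)" by (simp add: cvec_mult[symmetric] inner_cvec)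
  also have "\<dots> \<le> t * (norm_P P (cvec y))\<^sup>2" using t'(2) by (simp add: norm_P_power2[OF P'])
  also have "\<dots> \<le> t * (a * sqrt (mu X P))\<^sup>2"
    using t'(1) ny norm_P_nonneg[OF P'] by (intro mult_left_mono power_mono) auto
  finally have 1: "x \<bullet> ((transpose (matpow A j) ** Q ** matpow A j) *v x) \<le> t * mu X P * a\<^sup>2"
    using mu by (simp add: power_mult_distrib mult_ac)
  have "q \<bullet> (matpow A j *v x) = cvec q \<bullet> cvec y" by (simp add: y_def inner_cvec)
  also have "\<dots> \<le> dual_norm_P P (cvec q) * norm_P P (cvec y)"
    by (rule dual_norm_P_Cauchy_Schwarz[OF P'])
  also have "\<dots> \<le> dual_norm_P P (cvec q) * (a * sqrt (mu X P))"
    using ny dual_norm_P_nonneg[OF P'] by (intro mult_left_mono) auto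
  finally have "q \<bullet> (matpow A j *v x) \<le> sqrt (mu X P) * dual_norm_P P (cvec q) * a"
    by (simp add: mult_ac)
  with 1 show "x \<bullet> ((transpose (matpow A j) ** Q ** matpow A j) *v x) + q \<bullet> (matpow A j *v x)
      \<le> H q X P t (opnorm_P P A ^ j)"
    by (simp add: H_eq[OF t'(1) mu] a_def)
qed

text \<open>The intermediate value theorem only has to reach up to the given \<open>b\<close> with \<open>y \<le> H b\<close>; in the
  application such a \<open>b\<close> comes from the envelope.\<close>

lemma H_inv_of_attained:
  assumes mono: "strict_mono_on {0..} (H q X P t)" and t: "0 \<le> t" and mu: "0 < mu X P"
    and b: "0 \<le> b" and y: "0 < y" "y \<le> H q X P t b"
  shows "0 < H_inv q X P t y" "H q X P t (H_inv q X P t y) = y"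
proof -
  let ?H = "H q X P t"
  have H0: "?H 0 = 0" by (simp add: H_eq[OF t mu])
  have "continuous_on {0..b} ?H"
    unfolding H_eq[OF t mu, abs_def] by (intro continuous_intros)
  then obtain h where h: "0 \<le> h" "h \<le> b" "?H h = y"
    using IVT'[of ?H 0 y b] y b H0 by auto
  have "h \<noteq> 0" using h(3) H0 y(1) by auto
  moreover have "inv_into {0..} ?H y = h"
    using h by (intro inv_into_f_eq strict_mono_on_imp_inj_on[OF mono]) auto
  ultimately show "0 < H_inv q X P t y" "?H (H_inv q X P t y) = y"
    using h by (simp_all add: H_inv_def)
qed

text \<open>The logarithms and the floor encode a comparison: \<open>K_lyap_at\<close> is the first exponent \<open>i\<close> at
  which the decreasing envelope \<open>H (opnorm_P P A ^ i)\<close> has dropped below the value \<open>nu j\<close>. All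
  properties of \<open>K_lyap_at\<close> are derived from this description.\<close>

lemma less_K_lyap_at_iff:
  fixes A Q :: "real^'n^'n"
  assumes P: "P \<in> lyap A" and A: "0 < spectral_radius A" and Q: "transpose Q = Q"
    and X: "compact X" "X \<noteq> {}" "X \<noteq> {0}" and t: "t \<in> T_set Q P"
    and q: "pos_semidef (- cmat Q) \<longrightarrow> q \<noteq> 0" and j: "j \<in> Pos_nu A Q q X"
  shows "int i < K_lyap_at A Q q X j P t \<longleftrightarrow> nu A Q q X j \<le> H q X P t (opnorm_P P A ^ i)"
proof -
  define a where "a = opnorm_P P A"
  define y where "y = nu A Q q X j"
  define h where "h = H_inv q X P t y"
  have P': "pos_def P" using P by (simp add: lyap_def)
  have a: "0 < a" "a < 1" unfolding a_def by (rule opnorm_P_pos[OF P A], rule opnorm_P_less_1[OF P])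
  have mono: "strict_mono_on {0..} (H q X P t)" by (rule H_strict_mono[OF P' X t q])
  have "0 \<le> t" using t by (simp add: T_set_def)
  have "0 < y" using j by (simp add: Pos_nu_def y_def)
  have "y \<le> H q X P t (a ^ j)" unfolding a_def y_def by (rule nu_le_H[OF P A Q X t])
  then have h: "0 < h" "H q X P t h = y"
    unfolding h_def using H_inv_of_attained[OF mono \<open>0 \<le> t\<close> mu_pos[OF P' X]] a \<open>0 < y\<close>
    by (metis less_imp_le zero_less_power)+
  have "int i < K_lyap_at A Q q X j P t \<longleftrightarrow> real i \<le> ln h / ln a"
    unfolding K_lyap_at_def h_def y_def a_def by linarith
  also have "\<dots> \<longleftrightarrow> ln h \<le> real i * ln a" using a by (simp add: neg_le_divide_eq)
  also have "\<dots> \<longleftrightarrow> ln h \<le> ln (a ^ i)" using a by (simp add: ln_realpow)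
  also have "\<dots> \<longleftrightarrow> h \<le> a ^ i" using a h by simp
  also have "\<dots> \<longleftrightarrow> H q X P t h \<le> H q X P t (a ^ i)"
    using strict_mono_on_less_eq[OF mono, of h "a ^ i"] a h by simp
  finally show ?thesis using h(2) by (simp add: y_def a_def)
qed

section \<open>The position of the maximum\<close>

text \<open>If all terms from \<open>K\<close> on lie below some earlier term, the sequence has a maximum, attained only
  before \<open>K\<close>. An index \<open>n\<close> is dominating exactly if the maximum is attained at some index up to
  \<open>n\<close>, so the least dominating index is the first position of the maximum.\<close>

lemma first_dominating_index:
  fixes f :: "nat \<Rightarrow> real"
  defines "D \<equiv> {k. Max (f ` {0..k}) \<ge> (SUP j\<in>{k<..}. f j)}"
  assumes k: "k < K" and tail: "\<And>i. K \<le> i \<Longrightarrow> f i < f k"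
  shows "D \<noteq> {}" and "Inf D < K" and "\<And>i. f i \<le> f (Inf D)"
proof -
  have "Max (f ` {..<K}) \<in> f ` {..<K}" using k by (intro Max_in) auto
  then obtain m where m: "m < K" "f m = Max (f ` {..<K})" by auto
  have max: "f i \<le> f m" for i
  proof (cases "i < K")
    case True
    then show ?thesis unfolding m(2) by (intro Max_ge) auto
  next
    case False
    then have "f i < f k" by (intro tail) simp
    also have "f k \<le> f m" unfolding m(2) using k by (intro Max_ge) auto
    finally show ?thesis by simp
  qed
  have attained: "n \<in> D" if "f l = f m" "l \<le> n" for l n
  proof -
    have "(SUP j\<in>{n<..}. f j) \<le> f l" using max that by (intro cSUP_least) auto
    also have "\<dots> \<le> Max (f ` {0..n})" using that(2) by (intro Max_ge) auto
    finally show ?thesis by (simp add: D_def)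
  qed
  then have mD: "m \<in> D" by blast
  then show "D \<noteq> {}" by blast
  then have "Inf D \<in> D" by (rule Inf_nat_def1)
  have "Inf D \<le> m" using mD by (rule cInf_lower) simp
  with m(1) show "Inf D < K" by simp
  have "f m \<le> Max (f ` {0..Inf D})"
  proof (cases "m \<le> Inf D")
    case False
    then have "f m \<le> (SUP j\<in>{Inf D<..}. f j)"
      using max by (intro cSUP_upper bdd_aboveI[where M="f m"]) auto
    then show ?thesis using \<open>Inf D \<in> D\<close> by (simp add: D_def)
  qed (intro Max_ge, auto)
  moreover have "Max (f ` {0..Inf D}) \<in> f ` {0..Inf D}" by (intro Max_in) auto
  ultimately obtain l where l: "l \<le> Inf D" "f m \<le> f l" by (metis atLeastAtMost_iff imageE)
  then have "f l = f m" using max[of l] by simp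
  then have "l \<in> D" by (rule attained) simp
  then have "Inf D \<le> l" by (rule cInf_lower) simp
  with l \<open>f l = f m\<close> have "f (Inf D) = f m" by simp
  with max show "\<And>i. f i \<le> f (Inf D)" by simp
qed

text \<open>Transfers comparisons from \<open>less_K_lyap_at_iff\<close>, which only speaks of natural exponents.\<close>

lemma int_le_of_nat_less_imp:
  assumes "0 \<le> b" and "\<And>i. int i < a \<Longrightarrow> int i < b"
  shows "a \<le> b"
  using assms(2)[of "nat b"] assms(1) by linarith

text \<open>The integers are not well-ordered; the bound from below reduces the claim to the naturals.\<close>

lemma is_minimum_Least:
  fixes S :: "int set"
  assumes "S \<noteq> {}" and "\<And>s. s \<in> S \<Longrightarrow> 0 \<le> s"
  shows "is_minimum S (LEAST m. m \<in> S)"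
proof -
  define n where "n = (LEAST n. int n \<in> S)"
  obtain s where "s \<in> S" using assms(1) by blast
  then have "int (nat s) \<in> S" using assms(2) by simp
  then have "int n \<in> S" unfolding n_def by (rule LeastI)
  moreover have "int n \<le> s" if "s \<in> S" for s
  proof -
    have "int (nat s) \<in> S" using that assms(2) by simp
    then have "n \<le> nat s" unfolding n_def by (rule Least_le)
    then show ?thesis using assms(2)[OF that] by simp
  qed
  ultimately have "(LEAST m. m \<in> S) = int n" by (intro Least_equality)
  with \<open>int n \<in> S\<close> \<open>\<And>s. s \<in> S \<Longrightarrow> int n \<le> s\<close> show ?thesis by (simp add: is_minimum_def)
qed

theorem theorem4:
  fixes A Q :: "real^'n^'n" and q :: "real^'n" and X :: "(real^'n) set" and k :: nat
  assumes "transpose Q = Q"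
    and "polytope X" and "X \<noteq> {}" and "X \<noteq> {0}"
    and "0 < spectral_radius A" and "spectral_radius A < 1"
    and "pos_semidef (- cmat Q) \<longrightarrow> q \<noteq> 0"
    and "\<forall>(P, t) \<in> lyap_pairs A Q. nu A Q q X 0 < H q X P t 1"
    and "k \<in> Pos_nu A Q q X"
  shows
    "(\<forall>j \<in> Pos_nu A Q q X.
        is_minimum ((\<lambda>(P, t). K_lyap_at A Q q X j P t) ` lyap_pairs A Q) (K_lyap A Q q X j)) \<and>
     (\<forall>P \<in> lyap A. mono_on (T_set Q P) (\<lambda>t. K_lyap_at A Q q X k P t)) \<and>
     is_minimum ((\<lambda>P. K_lyap_at A Q q X k P (t_star Q P)) ` lyap A) (K_lyap A Q q X k) \<and>
     (dominating A Q q X \<noteq> {} \<and> int (K_nu A Q q X) < K_lyap A Q q X k) \<and>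
     (K_nu A Q q X \<in> Pos_nu A Q q X \<and>
        is_minimum (K_lyap A Q q X ` Pos_nu A Q q X) (K_lyap A Q q X (K_nu A Q q X))) \<and>
     (\<forall>i \<in> Pos_nu A Q q X.
        is_maximum (range (nu A Q q X))
          (Max (nu A Q q X ` {j. int j \<le> K_lyap A Q q X (K_nu A Q q X) - 1})) \<and>
        is_maximum (range (nu A Q q X))
          (Max (nu A Q q X ` {j. int j \<le> K_lyap A Q q X i - 1})))"
proof -
  note Q = assms(1) and A = assms(5) and q = assms(7)
  define \<nu> where "\<nu> = nu A Q q X"
  define Pos where "Pos = Pos_nu A Q q X"
  define K where "K = K_lyap A Q q X"
  define Kat where "Kat j P t = K_lyap_at A Q q X j P t" for j P t
  define m where "m = K_nu A Q q X"
  have X: "compact X" "X \<noteq> {}" "X \<noteq> {0}"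
    using assms(2-4) by (auto simp: polytope_imp_compact)
  have pd: "pos_def P" if "P \<in> lyap A" for P using that by (simp add: lyap_def)
  have less_iff: "int i < Kat j P t \<longleftrightarrow> \<nu> j \<le> H q X P t (opnorm_P P A ^ i)"
    if "P \<in> lyap A" "t \<in> T_set Q P" "j \<in> Pos" for i j P t
    using less_K_lyap_at_iff[OF that(1) A Q X that(2) q] that(3)
    by (simp add: \<nu>_def Pos_def Kat_def)
  have envelope: "\<nu> j \<le> H q X P t (opnorm_P P A ^ j)"
    if "P \<in> lyap A" "t \<in> T_set Q P" for j P t
    unfolding \<nu>_def by (rule nu_le_H[OF that(1) A Q X that(2)])
  have Kat_gt: "int j < Kat j P t" if "P \<in> lyap A" "t \<in> T_set Q P" "j \<in> Pos" for j P t
    using less_iff[OF that] envelope that by blast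
  have T_star: "t_star Q P \<in> T_set Q P" "\<And>t. t \<in> T_set Q P \<Longrightarrow> t_star Q P \<le> t"
    if "P \<in> lyap A" for P
    using t_star_is_minimum[OF pd[OF that] Q] by (auto simp: is_minimum_def)
  have pairs_iff: "(P, t) \<in> lyap_pairs A Q \<longleftrightarrow> P \<in> lyap A \<and> t \<in> T_set Q P" for P t
    by (simp add: lyap_pairs_def)
  have pairs: "lyap_pairs A Q \<noteq> {}"
    using lyap_nonempty[OF assms(6)] T_star(1) pairs_iff by blast
  have K_min: "is_minimum ((\<lambda>(P, t). Kat j P t) ` lyap_pairs A Q) (K j)" if "j \<in> Pos" for j
    unfolding K_def K_lyap_def Kat_def
  proof (rule is_minimum_Least)
    fix s assume "s \<in> (\<lambda>(P, t). K_lyap_at A Q q X j P t) ` lyap_pairs A Q"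
    then obtain P t where "P \<in> lyap A" "t \<in> T_set Q P" "s = Kat j P t"
      by (auto simp: pairs_iff Kat_def)
    then show "0 \<le> s" using Kat_gt[of P t j] that by simp
  qed (use pairs in auto)
  have K_le: "K j \<le> Kat j P t" if "P \<in> lyap A" "t \<in> T_set Q P" "j \<in> Pos" for j P t
  proof -
    have "Kat j P t \<in> (\<lambda>(P, t). Kat j P t) ` lyap_pairs A Q"
      using that by (intro image_eqI[of _ _ "(P, t)"]) (auto simp: pairs_iff)
    then show ?thesis using K_min[OF that(3)] unfolding is_minimum_def by blast
  qed
  have K_attained: "\<exists>P t. P \<in> lyap A \<and> t \<in> T_set Q P \<and> K j = Kat j P t" if "j \<in> Pos" for j
  proof -
    have "K j \<in> (\<lambda>(P, t). Kat j P t) ` lyap_pairs A Q"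
      using K_min[OF that] unfolding is_minimum_def by blast
    then show ?thesis using pairs_iff by (elim imageE) (metis case_prod_conv surj_pair)
  qed
  have mono_t: "Kat j P s \<le> Kat j P t"
    if "P \<in> lyap A" "s \<in> T_set Q P" "t \<in> T_set Q P" "s \<le> t" "j \<in> Pos" for j P s t
  proof (rule int_le_of_nat_less_imp)
    show "0 \<le> Kat j P t" using Kat_gt[of P t j] that by simp
    show "int i < Kat j P t" if "int i < Kat j P s" for i
    proof -
      have "\<nu> j \<le> H q X P s (opnorm_P P A ^ i)" using that less_iff \<open>P \<in> lyap A\<close> \<open>s \<in> _\<close> \<open>j \<in> Pos\<close> by blast
      also have "\<dots> \<le> H q X P t (opnorm_P P A ^ i)"
        using \<open>s \<in> _\<close> \<open>s \<le> t\<close> mu_pos[OF pd[OF \<open>P \<in> lyap A\<close>] X] by (intro H_mono_t) (auto simp: T_set_def)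
      finally show ?thesis using less_iff \<open>P \<in> lyap A\<close> \<open>t \<in> _\<close> \<open>j \<in> Pos\<close> by blast
    qed
  qed
  \<comment> \<open>A larger value is reached earlier by the decreasing envelope.\<close>
  have antimono: "K i \<le> K j" if "i \<in> Pos" "j \<in> Pos" "\<nu> j \<le> \<nu> i" for i j
  proof -
    obtain P t where P: "P \<in> lyap A" "t \<in> T_set Q P" "K j = Kat j P t"
      using K_attained[OF \<open>j \<in> Pos\<close>] by blast
    have "Kat i P t \<le> Kat j P t"
    proof (rule int_le_of_nat_less_imp)
      show "0 \<le> Kat j P t" using Kat_gt[of P t j] that P by simp
      show "int n < Kat j P t" if "int n < Kat i P t" for n
        using that less_iff[OF P(1,2)] \<open>i \<in> Pos\<close> \<open>j \<in> Pos\<close> \<open>\<nu> j \<le> \<nu> i\<close> by force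
    qed
    with K_le[OF P(1,2) \<open>i \<in> Pos\<close>] P(3) show ?thesis by simp
  qed
  \<comment> \<open>Once the envelope is below \<open>\<nu> j\<close>, so is the sequence, which stays below the envelope.\<close>
  have tail: "int j < K j" "int i < K j \<or> \<nu> i < \<nu> j" if "j \<in> Pos" for i j
  proof -
    obtain P t where P: "P \<in> lyap A" "t \<in> T_set Q P" "K j = Kat j P t"
      using K_attained[OF \<open>j \<in> Pos\<close>] by blast
    show "int j < K j" using Kat_gt[OF P(1,2) that] P(3) by simp
    show "int i < K j \<or> \<nu> i < \<nu> j"
      using less_iff[OF P(1,2) that, of i] envelope[OF P(1,2), of i] P(3) by auto
  qed
  have dom: "dominating A Q q X \<noteq> {}" "int m < K j" "\<nu> i \<le> \<nu> m" if "j \<in> Pos" for i j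
  proof -
    have j: "j < nat (K j)" using tail(1)[OF that] by linarith
    have *: "\<nu> n < \<nu> j" if "nat (K j) \<le> n" for n
      using tail(2)[OF \<open>j \<in> Pos\<close>, of n] that by linarith
    note first = first_dominating_index[of j "nat (K j)" \<nu>, OF j *, folded dominating_def]
    show "dominating A Q q X \<noteq> {}" "int m < K j" "\<nu> i \<le> \<nu> m"
      using first by (auto simp: \<nu>_def dominating_def m_def K_nu_def)
  qed
  have k: "k \<in> Pos" using assms(9) by (simp add: Pos_def)
  have m: "m \<in> Pos"
    using dom(3)[OF k, of k] k by (auto simp: Pos_def Pos_nu_def \<nu>_def)
  have part2: "is_minimum ((\<lambda>P. Kat k P (t_star Q P)) ` lyap A) (K k)"
    unfolding is_minimum_def
  proof (intro conjI ballI)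
    obtain P t where P: "P \<in> lyap A" "t \<in> T_set Q P" "K k = Kat k P t"
      using K_attained[OF k] by blast
    have "K k = Kat k P (t_star Q P)"
      using mono_t[OF P(1) T_star(1) P(2) T_star(2) k] K_le[OF P(1) T_star(1) k] P by force
    then show "K k \<in> (\<lambda>P. Kat k P (t_star Q P)) ` lyap A" using P(1) by blast
  next
    fix s assume "s \<in> (\<lambda>P. Kat k P (t_star Q P)) ` lyap A"
    then show "K k \<le> s" using K_le T_star(1) k by blast
  qed
  have part4: "is_minimum (K ` Pos) (K m)"
    using m antimono dom(3) by (auto simp: is_minimum_def)
  have part5: "is_maximum (range \<nu>) (Max (\<nu> ` {j. int j \<le> K i - 1}))" if "i \<in> Pos" for i
  proof -
    let ?J = "{j. int j \<le> K i - 1}"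
    have "?J \<subseteq> {..nat (K i)}" by auto
    then have fin: "finite ?J" by (rule finite_subset) simp
    have "m \<in> ?J" using dom(2)[OF that] by simp
    then have "Max (\<nu> ` ?J) = \<nu> m"
      using fin dom(3)[OF that] by (intro Max_eqI) auto
    then show ?thesis using dom(3)[OF that] by (auto simp: is_maximum_def)
  qed
  show ?thesis
    using K_min mono_t[OF _ _ _ _ k] part2 dom(1)[OF k] dom(2)[OF k] m part4 part5
    unfolding \<nu>_def Pos_def K_def Kat_def m_def
    by (auto intro!: mono_onI)
qed

end
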